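(* Let $\Gamma$ be a finitely generated cocompact lattice of a tdlc group $G$, and let $C$ be a dense subgroup of $G$ such that $\Gamma \leq C \leq \mathrm{Comm}_G(\Gamma)$. Suppose: (1) $G$ admits a compact open subgroup with trivial normal core in $G$; (2) every closed normal subgroup of $G$ is discrete or open; (3) $G$ is not locally finitely generated. Then every finitely generated commensurated subgroup of $C$ is virtually contained in $\Gamma$.
   Context: A tdlc group is a totally disconnected locally compact group. A cocompact lattice of a locally compact group $G$ is a discrete subgroup $\Gamma$ of $G$ such that $G/\Gamma$ is compact. Two subgroups of a group are commensurable if their intersection has finite index in each of them. $\mathrm{Comm}_G(\Gamma)$ is the set of $g\in G$ such that $\Gamma$ and $g\Gamma g^{-1}$ are commensurable. A subgroup $H$ of a group $C$ is commensurated in $C$ if $H$ and $cHc^{-1}$ are commensurable for every $c\in C$. A subgroup $H$ is virtually contained in a subgroup $\Gamma$ if some finite index subgroup of $H$ is contained in $\Gamma$. The normal core of a subgroup $L$ of $G$ is $\bigcap_{g\in G} gLg^{-1}$. A profinite group is finitely generated if it has a dense finitely generated subgroup. A tdlc group is locally finitely generated if some (equivalently every) compact open subgroup of it is a finitely generated profinite group. *)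

theory Defs
  imports "HOL-Analysis.Analysis" "HOL-Algebra.Generated_Groups"
begin

section \<open>Abstract groups\<close>

definition conjugate_subgroup :: "('a, 'b) monoid_scheme \<Rightarrow> 'a \<Rightarrow> 'a set \<Rightarrow> 'a set" where
  "conjugate_subgroup G g H = g <#\<^bsub>G\<^esub> H #>\<^bsub>G\<^esub> inv\<^bsub>G\<^esub> g"

definition normal_core :: "('a, 'b) monoid_scheme \<Rightarrow> 'a set \<Rightarrow> 'a set" where
  "normal_core G L = (\<Inter>g\<in>carrier G. conjugate_subgroup G g L)"

definition finitely_generated_subgroup :: "('a, 'b) monoid_scheme \<Rightarrow> 'a set \<Rightarrow> bool" where
  "finitely_generated_subgroup G H \<longleftrightarrow>
     (\<exists>S. finite S \<and> S \<subseteq> carrier G \<and> H = generate G S)"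

definition finite_index :: "('a, 'b) monoid_scheme \<Rightarrow> 'a set \<Rightarrow> 'a set \<Rightarrow> bool" where
  "finite_index G K H \<longleftrightarrow>
     subgroup K G \<and> subgroup H G \<and> K \<subseteq> H \<and> finite (rcosets\<^bsub>G\<lparr>carrier := H\<rparr>\<^esub> K)"

definition commensurable :: "('a, 'b) monoid_scheme \<Rightarrow> 'a set \<Rightarrow> 'a set \<Rightarrow> bool" where
  "commensurable G H K \<longleftrightarrow> finite_index G (H \<inter> K) H \<and> finite_index G (H \<inter> K) K"

definition commensurator :: "('a, 'b) monoid_scheme \<Rightarrow> 'a set \<Rightarrow> 'a set" where
  "commensurator G H = {g \<in> carrier G. commensurable G H (conjugate_subgroup G g H)}"

definition commensurated_in :: "('a, 'b) monoid_scheme \<Rightarrow> 'a set \<Rightarrow> 'a set \<Rightarrow> bool" where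
  "commensurated_in G H C \<longleftrightarrow>
     subgroup H G \<and> subgroup C G \<and> H \<subseteq> C \<and>
     (\<forall>c\<in>C. commensurable G H (conjugate_subgroup G c H))"

definition virtually_contained :: "('a, 'b) monoid_scheme \<Rightarrow> 'a set \<Rightarrow> 'a set \<Rightarrow> bool" where
  "virtually_contained G H \<Gamma> \<longleftrightarrow> (\<exists>K. finite_index G K H \<and> K \<subseteq> \<Gamma>)"


section \<open>Topological groups\<close>

locale topological_group = group G
  for G :: "('a, 'b) monoid_scheme" (structure) +
  fixes T :: "'a topology"
  assumes topspace_eq_carrier: "topspace T = carrier G"
    and continuous_mult: "continuous_map (prod_topology T T) T (\<lambda>(x, y). x \<otimes> y)"
    and continuous_inv: "continuous_map T T (\<lambda>x. inv x)"

locale tdlc_group = topological_group +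
  assumes Hausdorff: "Hausdorff_space T"
    and locally_compact: "locally_compact_space T"
    and totally_disconnected: "\<forall>K \<in> connected_components_of T. \<exists>x. K = {x}"

definition discrete_subset :: "'a topology \<Rightarrow> 'a set \<Rightarrow> bool" where
  "discrete_subset T S \<longleftrightarrow> S \<subseteq> topspace T \<and> subtopology T S = discrete_topology S"

definition compact_open_subgroup :: "('a, 'b) monoid_scheme \<Rightarrow> 'a topology \<Rightarrow> 'a set \<Rightarrow> bool" where
  "compact_open_subgroup G T U \<longleftrightarrow> subgroup U G \<and> compactin T U \<and> openin T U"

definition left_cosets :: "('a, 'b) monoid_scheme \<Rightarrow> 'a set \<Rightarrow> 'a set set" where
  "left_cosets G H = (\<lambda>g. g <#\<^bsub>G\<^esub> H) ` carrier G"

definition coset_topology ::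
    "('a, 'b) monoid_scheme \<Rightarrow> 'a topology \<Rightarrow> 'a set \<Rightarrow> 'a set topology" where
  "coset_topology G T H = topology (\<lambda>\<U>. \<U> \<subseteq> left_cosets G H \<and>
     openin T {g \<in> topspace T. g <#\<^bsub>G\<^esub> H \<in> \<U>})"

lemma openin_coset_topology:
  "openin (coset_topology G T H) \<U> \<longleftrightarrow>
     \<U> \<subseteq> left_cosets G H \<and> openin T {g \<in> topspace T. g <#\<^bsub>G\<^esub> H \<in> \<U>}"
proof -
  let ?P = "\<lambda>\<U>. \<U> \<subseteq> left_cosets G H \<and> openin T {g \<in> topspace T. g <#\<^bsub>G\<^esub> H \<in> \<U>}"
  have int: "?P (A \<inter> B)" if "?P A" "?P B" for A B
  proof -
    have "{g \<in> topspace T. g <#\<^bsub>G\<^esub> H \<in> A \<inter> B} =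
        {g \<in> topspace T. g <#\<^bsub>G\<^esub> H \<in> A} \<inter> {g \<in> topspace T. g <#\<^bsub>G\<^esub> H \<in> B}"
      by auto
    with that show ?thesis by auto
  qed
  have un: "?P (\<Union>\<K>)" if "\<forall>K\<in>\<K>. ?P K" for \<K>
  proof -
    have "{g \<in> topspace T. g <#\<^bsub>G\<^esub> H \<in> \<Union>\<K>} =
        (\<Union>K\<in>\<K>. {g \<in> topspace T. g <#\<^bsub>G\<^esub> H \<in> K})"
      by auto
    with that show ?thesis by auto
  qed
  have "istopology ?P"
    unfolding istopology_def using int un by blast
  then show ?thesis
    unfolding coset_topology_def by (simp add: topology_inverse')
qed

lemma (in topological_group) topspace_coset_topology:
  "topspace (coset_topology G T H) = left_cosets G H"
proof -
  have "{g \<in> topspace T. g <# H \<in> left_cosets G H} = topspace T"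
    by (auto simp: left_cosets_def topspace_eq_carrier)
  then have "openin (coset_topology G T H) (left_cosets G H)"
    by (simp add: openin_coset_topology)
  then show ?thesis
    by (metis openin_coset_topology openin_subset openin_topspace subset_antisym)
qed

lemma (in topological_group) quotient_map_coset_topology:
  "quotient_map T (coset_topology G T H) (\<lambda>g. g <# H)"
  unfolding quotient_map_def
  by (auto simp: topspace_coset_topology openin_coset_topology left_cosets_def topspace_eq_carrier)

definition cocompact_lattice :: "('a, 'b) monoid_scheme \<Rightarrow> 'a topology \<Rightarrow> 'a set \<Rightarrow> bool" where
  "cocompact_lattice G T \<Gamma> \<longleftrightarrow>
     subgroup \<Gamma> G \<and> discrete_subset T \<Gamma> \<and> compact_space (coset_topology G T \<Gamma>)"

definition topologically_finitely_generated ::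
    "('a, 'b) monoid_scheme \<Rightarrow> 'a topology \<Rightarrow> 'a set \<Rightarrow> bool" where
  "topologically_finitely_generated G T U \<longleftrightarrow>
     (\<exists>D. finitely_generated_subgroup G D \<and> D \<subseteq> U \<and> subtopology T U closure_of D = U)"

definition locally_finitely_generated :: "('a, 'b) monoid_scheme \<Rightarrow> 'a topology \<Rightarrow> bool" where
  "locally_finitely_generated G T \<longleftrightarrow>
     (\<exists>U. compact_open_subgroup G T U \<and> topologically_finitely_generated G T U)"

end

theory Submission
  imports Defs
begin

text \<open>
  Let \<open>H\<close> be a finitely generated commensurated subgroup of \<open>C\<close>. For a finite nonempty
  \<open>F \<subseteq> C\<close>, put \<open>\<Gamma>\<^sub>F = (\<Inter>c\<in>F. c\<Gamma>c\<inverse>)\<close> and \<open>H\<^sub>F = (\<Inter>c\<in>F. cHc\<inverse>)\<close>, and let \<open>A\<^sub>F\<close>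
  be the closure of the subgroup generated by \<open>\<Gamma>\<^sub>F \<union> H\<^sub>F\<close> (\<open>joint_hull\<close>). Since \<open>C\<close> commensurates
  both groups, \<open>\<Gamma>\<^sub>F\<close> and \<open>H\<^sub>F\<close> are commensurable with \<open>\<Gamma>\<close> and \<open>H\<close>. It is enough to find an \<open>F\<close>
  containing \<open>\<one>\<close> for which \<open>A\<^sub>F\<close> is discrete: \<open>\<Gamma>\<^sub>F\<close> is then a cocompact subgroup of a discrete group, hence of finite
  index, and so \<open>H\<^sub>F \<inter> \<Gamma>\<^sub>F\<close> has finite index in \<open>H\<^sub>F\<close>, which has finite index in \<open>H\<close>
  (\<open>finite_index_Int_if_discrete_cocompact\<close>).
  
  The groups \<open>A\<^sub>F\<close> form a downward directed family, and conjugation by \<open>c \<in> C\<close> carries \<open>A\<^sub>F\<close> to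
  \<open>A\<close> indexed by \<open>cF\<close>. Their intersection \<open>N\<close> (\<open>hull_residue\<close>) is therefore a closed subgroup normalised by the dense
  subgroup \<open>C\<close>, hence normal in the whole group, and so it is discrete or open.
  
  It is not open. Otherwise the closure of \<open>P = \<langle>\<Gamma>, H\<rangle>\<close>, which contains \<open>N\<close>, is open. For a
  compact open subgroup \<open>U\<close>, the group \<open>P \<inter> U\<close> acts on \<open>P / \<Gamma>\<close> with finitely many orbits,
  because \<open>\<Gamma>\<close> is cocompact, and with finite stabilisers, because \<open>\<Gamma>\<close> is discrete. As \<open>P\<close> is
  finitely generated and commensurates \<open>\<Gamma>\<close>, the set \<open>P / \<Gamma>\<close> carries a connected locally finite graph
  structure preserved by \<open>P\<close>; so \<open>P \<inter> U\<close> is finitely generated (\<open>finitely_generated_Int\<close>). It is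
  dense in the compact open subgroup that \<open>U\<close> cuts out of the closure of \<open>P\<close>, so the ambient group is locally finitely generated,
  a contradiction.
  
  So \<open>N\<close> is discrete. Choose a compact open subgroup \<open>V\<close> with \<open>N \<inter> V = {\<one>}\<close>, so small that
  the \<open>\<Gamma>\<close>-conjugates of \<open>V\<close> intersect trivially; cocompactness of \<open>\<Gamma>\<close> and a compact open
  subgroup with trivial normal core provide one. By compactness, some \<open>A\<^sub>F\<close> satisfies \<open>A\<^sub>F \<inter> V \<subseteq> sVs\<inverse>\<close> for
  each \<open>s\<close> in a finite symmetric generating set of \<open>\<Gamma>\<close>. Only finitely many groups are conjugate to
  \<open>A\<^sub>F\<close> under \<open>\<Gamma>\<close>, because \<open>\<Gamma>\<^sub>F\<close> normalises \<open>A\<^sub>F\<close>, so some \<open>A\<close> indexed by a larger set lies in all of them.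
  An element of that group and of \<open>V\<close> then lies in \<open>\<gamma>V\<gamma>\<inverse>\<close> for each \<open>\<gamma> \<in> \<Gamma>\<close>, by
  induction on the word length of \<open>\<gamma>\<close>, and is trivial (\<open>hull_avoids_compact_open_subgroup\<close>). So that
  group is discrete.
\<close>

section \<open>Conjugates, finite index and finite generation\<close>

text \<open>
  For \<open>F = carrier G\<close> this is the normal core. Finite \<open>F\<close> are the case of interest: they replace
  an arbitrary commensurable subgroup by one that conjugation moves in a controlled way, since
  conjugating by \<open>g\<close> just translates the index set \<open>F\<close> to \<open>gF\<close>.
\<close>

definition conjugate_core :: "('a, 'b) monoid_scheme \<Rightarrow> 'a set \<Rightarrow> 'a set \<Rightarrow> 'a set" where
  "conjugate_core G F X = (\<Inter>c\<in>F. conjugate_subgroup G c X)"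

context group
begin

lemma mem_conjugate_subgroup:
  assumes "X \<subseteq> carrier G" "g \<in> carrier G"
  shows "x \<in> conjugate_subgroup G g X \<longleftrightarrow> x \<in> carrier G \<and> inv g \<otimes> x \<otimes> g \<in> X"
proof
  assume "x \<in> conjugate_subgroup G g X"
  then obtain y where y: "y \<in> X" "x = g \<otimes> y \<otimes> inv g"
    unfolding conjugate_subgroup_def l_coset_def r_coset_def by auto
  then have "y \<in> carrier G" using assms by auto
  then have "inv g \<otimes> x \<otimes> g = y"
    using y assms by (simp add: m_assoc) (simp add: m_assoc [symmetric])
  then show "x \<in> carrier G \<and> inv g \<otimes> x \<otimes> g \<in> X"
    using y assms \<open>y \<in> carrier G\<close> by auto
next
  assume x: "x \<in> carrier G \<and> inv g \<otimes> x \<otimes> g \<in> X"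
  then have "x = g \<otimes> (inv g \<otimes> x \<otimes> g) \<otimes> inv g"
    using assms by (simp add: m_assoc) (simp add: m_assoc [symmetric])
  then show "x \<in> conjugate_subgroup G g X"
    using x unfolding conjugate_subgroup_def l_coset_def r_coset_def by blast
qed

lemma conj_mult:
  assumes "g \<in> carrier G" "x \<in> carrier G" "y \<in> carrier G"
  shows "inv g \<otimes> (x \<otimes> y) \<otimes> g = (inv g \<otimes> x \<otimes> g) \<otimes> (inv g \<otimes> y \<otimes> g)"
  using assms by (simp add: m_assoc inv_solve_left) (simp add: m_assoc [symmetric])

lemma conj_inv:
  assumes "g \<in> carrier G" "x \<in> carrier G"
  shows "inv g \<otimes> inv x \<otimes> g = inv (inv g \<otimes> x \<otimes> g)"
  using assms by (simp add: inv_mult_group m_assoc)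

lemma conj_conj:
  assumes "g \<in> carrier G" "h \<in> carrier G" "x \<in> carrier G"
  shows "inv (g \<otimes> h) \<otimes> x \<otimes> (g \<otimes> h) = inv h \<otimes> (inv g \<otimes> x \<otimes> g) \<otimes> h"
  using assms by (simp add: inv_mult_group m_assoc)

lemma mem_conjugate_core:
  assumes "X \<subseteq> carrier G" "F \<subseteq> carrier G" "F \<noteq> {}"
  shows "x \<in> conjugate_core G F X \<longleftrightarrow> x \<in> carrier G \<and> (\<forall>c\<in>F. inv c \<otimes> x \<otimes> c \<in> X)"
proof -
  have "x \<in> conjugate_subgroup G c X \<longleftrightarrow> x \<in> carrier G \<and> inv c \<otimes> x \<otimes> c \<in> X"
    if "c \<in> F" for c
    using that assms by (intro mem_conjugate_subgroup) auto
  then show ?thesis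
    using \<open>F \<noteq> {}\<close> by (auto simp: conjugate_core_def)
qed

lemma subgroup_conjugate_core:
  assumes "subgroup X G" "F \<subseteq> carrier G" "F \<noteq> {}"
  shows "subgroup (conjugate_core G F X) G"
proof -
  interpret X: subgroup X G by fact
  have F: "c \<in> carrier G" if "c \<in> F" for c
    using that assms by auto
  note mem = mem_conjugate_core [OF X.subset assms(2,3)]
  show ?thesis
  proof (rule subgroupI)
    show "conjugate_core G F X \<subseteq> carrier G" using mem by blast
    have "\<one> \<in> conjugate_core G F X" using F by (simp add: mem)
    then show "conjugate_core G F X \<noteq> {}" by blast
    show "inv x \<in> conjugate_core G F X" if "x \<in> conjugate_core G F X" for x
      using that F by (simp add: mem conj_inv)
    show "x \<otimes> y \<in> conjugate_core G F X"
      if "x \<in> conjugate_core G F X" "y \<in> conjugate_core G F X" for x y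
      using that F by (simp add: mem conj_mult)
  qed
qed

lemma subgroup_conjugate_subgroup:
  assumes "subgroup X G" "c \<in> carrier G"
  shows "subgroup (conjugate_subgroup G c X) G"
  using subgroup_conjugate_core [OF assms(1), of "{c}"] assms(2)
  by (simp add: conjugate_core_def)

lemma conj_mem_conjugate_core:
  assumes "X \<subseteq> carrier G" "F \<subseteq> carrier G" "F \<noteq> {}" "g \<in> carrier G" "x \<in> carrier G"
  shows "inv g \<otimes> x \<otimes> g \<in> conjugate_core G F X \<longleftrightarrow> x \<in> conjugate_core G ((\<otimes>) g ` F) X"
proof -
  have eq: "inv (g \<otimes> c) \<otimes> x \<otimes> (g \<otimes> c) = inv c \<otimes> (inv g \<otimes> x \<otimes> g) \<otimes> c" if "c \<in> F" for c
    using that assms by (intro conj_conj) auto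
  have "(\<otimes>) g ` F \<subseteq> carrier G" "(\<otimes>) g ` F \<noteq> {}"
    using assms by auto
  then have "x \<in> conjugate_core G ((\<otimes>) g ` F) X \<longleftrightarrow>
      (\<forall>c\<in>F. inv (g \<otimes> c) \<otimes> x \<otimes> (g \<otimes> c) \<in> X)"
    using assms(1,5) by (subst mem_conjugate_core) simp_all
  also have "\<dots> \<longleftrightarrow> (\<forall>c\<in>F. inv c \<otimes> (inv g \<otimes> x \<otimes> g) \<otimes> c \<in> X)"
    by (intro ball_cong refl) (simp only: eq)
  also have "\<dots> \<longleftrightarrow> inv g \<otimes> x \<otimes> g \<in> conjugate_core G F X"
    using assms by (subst mem_conjugate_core) simp_all
  finally show ?thesis by blast
qed

lemma conjugate_core_antimono:
  "F \<subseteq> F' \<Longrightarrow> conjugate_core G F' X \<subseteq> conjugate_core G F X"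
  by (auto simp: conjugate_core_def)

lemma conjugate_core_one:
  assumes "X \<subseteq> carrier G"
  shows "conjugate_core G {\<one>} X = X"
proof -
  have "x \<in> conjugate_core G {\<one>} X \<longleftrightarrow> x \<in> X" for x
    using assms by (subst mem_conjugate_core) auto
  then show ?thesis by blast
qed

lemma conjugate_core_subset:
  "X \<subseteq> carrier G \<Longrightarrow> \<one> \<in> F \<Longrightarrow> conjugate_core G F X \<subseteq> X"
  using conjugate_core_one conjugate_core_antimono [of "{\<one>}" F X] by auto

lemma inv_mult_cancel_left:
  assumes "x \<in> carrier G" "k \<in> carrier G" "k' \<in> carrier G"
  shows "inv (x \<otimes> k) \<otimes> (x \<otimes> k') = inv k \<otimes> k'"
proof -
  have "inv (x \<otimes> k) \<otimes> (x \<otimes> k') = inv k \<otimes> ((inv x \<otimes> x) \<otimes> k')"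
    using assms by (simp only: inv_mult_group m_assoc inv_closed m_closed)
  then show ?thesis using assms by simp
qed

lemma mult_inv_cancel_right:
  assumes "x \<in> carrier G" "y \<in> carrier G" "k \<in> carrier G"
  shows "(x \<otimes> k) \<otimes> inv (y \<otimes> k) = x \<otimes> inv y"
proof -
  have "(x \<otimes> k) \<otimes> inv (y \<otimes> k) = x \<otimes> ((k \<otimes> inv k) \<otimes> inv y)"
    using assms by (simp only: inv_mult_group m_assoc inv_closed m_closed)
  then show ?thesis using assms by simp
qed

lemma finite_indexD:
  assumes "finite_index G K H"
  obtains R where "finite R" "R \<subseteq> H" "\<And>h. h \<in> H \<Longrightarrow> \<exists>r\<in>R. \<exists>k\<in>K. h = r \<otimes> k"
proof -
  interpret H: subgroup H G using assms by (simp add: finite_index_def)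
  interpret K: subgroup K G using assms by (simp add: finite_index_def)
  have KH: "K \<subseteq> H" and fin: "finite (rcosets\<^bsub>G\<lparr>carrier := H\<rparr>\<^esub> K)"
    using assms by (auto simp: finite_index_def)
  have rc: "rcosets\<^bsub>G\<lparr>carrier := H\<rparr>\<^esub> K = (\<lambda>h. K #> h) ` H"
    by (auto simp: RCOSETS_def r_coset_def)
  obtain Q where Q: "finite Q" "Q \<subseteq> H" "(\<lambda>h. K #> h) ` H = (\<lambda>h. K #> h) ` Q"
    using finite_subset_image [OF fin [unfolded rc] subset_refl] by metis
  show thesis
  proof
    show "finite (m_inv G ` Q)" "m_inv G ` Q \<subseteq> H" using Q by auto
    fix h assume h: "h \<in> H"
    then have "K #> inv h \<in> (\<lambda>h. K #> h) ` Q" using Q(3) by auto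
    then obtain q where q: "q \<in> Q" "K #> inv h = K #> q" by auto
    then have "inv h \<in> K #> q" using h rcos_self [OF _ K.subgroup_axioms, of "inv h"] by simp
    then obtain k where k: "k \<in> K" "inv h = k \<otimes> q" by (auto simp: r_coset_def)
    have "h = inv (inv h)" using h by simp
    also have "\<dots> = inv q \<otimes> inv k" using k q(1) Q(2) by (simp add: inv_mult_group subset_iff)
    finally show "\<exists>r\<in>m_inv G ` Q. \<exists>k\<in>K. h = r \<otimes> k" using k(1) q(1) by blast
  qed
qed

text \<open>
  A map \<open>f\<close> with finite image whose fibres lie in single left cosets is the most convenient
  certificate of finite index: finite intersections pair such maps, and in the topological argument
  the map names a double coset containing the given element.
\<close>

lemma finite_indexI:
  assumes "subgroup K G" "subgroup H G" "K \<subseteq> H" "finite (f ` H)"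
    and f: "\<And>h h'. h \<in> H \<Longrightarrow> h' \<in> H \<Longrightarrow> f h = f h' \<Longrightarrow> inv h \<otimes> h' \<in> K"
  shows "finite_index G K H"
proof -
  interpret H: subgroup H G by fact
  interpret K: subgroup K G by fact
  have "K #> h \<in> (\<lambda>y. K #> inv (SOME h. h \<in> H \<and> f h = y)) ` f ` H" if h: "h \<in> H" for h
  proof -
    define g where "g = (SOME g. g \<in> H \<and> f g = f (inv h))"
    have g: "g \<in> H \<and> f g = f (inv h)"
      unfolding g_def by (rule someI [where x = "inv h"]) (simp add: h)
    have "inv g \<otimes> inv h \<in> K"
      by (rule f) (use g h in auto)
    then have "inv (inv g \<otimes> inv h) \<in> K" by simp
    then have "h \<otimes> g \<in> K" using g h by (simp add: inv_mult_group)
    then have "h \<in> K #> inv g"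
      unfolding r_coset_def using g h by (auto intro!: bexI [of _ "h \<otimes> g"] simp: m_assoc)
    then have "K #> h = K #> inv g"
      using g h repr_independence [OF _ _ K.subgroup_axioms, of h "inv g"] by simp
    then show ?thesis using h g_def by (auto intro!: image_eqI [of _ _ "f (inv h)"])
  qed
  then have "(\<lambda>h. K #> h) ` H \<subseteq> (\<lambda>y. K #> inv (SOME h. h \<in> H \<and> f h = y)) ` f ` H"
    by blast
  then have "finite ((\<lambda>h. K #> h) ` H)"
    using assms(4) finite_surj by blast
  moreover have "rcosets\<^bsub>G\<lparr>carrier := H\<rparr>\<^esub> K = (\<lambda>h. K #> h) ` H"
    by (auto simp: RCOSETS_def r_coset_def)
  ultimately show ?thesis
    using assms by (simp add: finite_index_def)
qed

lemma cover_by_left_cosetsE: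
  assumes K: "subgroup K G" and R: "finite R" "R \<subseteq> carrier G"
    and cov: "\<And>h. h \<in> H \<Longrightarrow> \<exists>r\<in>R. \<exists>k\<in>K. h = r \<otimes> k"
  obtains f :: "'a \<Rightarrow> 'a" where "finite (f ` H)"
    "\<And>h h'. h \<in> H \<Longrightarrow> h' \<in> H \<Longrightarrow> f h = f h' \<Longrightarrow> inv h \<otimes> h' \<in> K"
proof -
  interpret K: subgroup K G by fact
  obtain f where f: "\<And>h. h \<in> H \<Longrightarrow> f h \<in> R" "\<And>h. h \<in> H \<Longrightarrow> \<exists>k\<in>K. h = f h \<otimes> k"
    using cov by metis
  have "f ` H \<subseteq> R" using f(1) by blast
  then have "finite (f ` H)" using R(1) finite_subset by blast
  moreover have "inv h \<otimes> h' \<in> K" if h: "h \<in> H" "h' \<in> H" "f h = f h'" for h h'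
  proof -
    define r where "r = f h"
    obtain k k' where k: "k \<in> K" "h = r \<otimes> k" "k' \<in> K" "h' = r \<otimes> k'"
      using f(2) [OF h(1)] f(2) [OF h(2)] h(3) unfolding r_def by metis
    have "r \<in> carrier G" using f(1) [OF h(1)] R(2) by (auto simp: r_def)
    then have "inv h \<otimes> h' = inv k \<otimes> k'"
      unfolding k(2,4) using k(1,3) by (intro inv_mult_cancel_left) auto
    then show ?thesis using k(1,3) by simp
  qed
  ultimately show thesis by (rule that)
qed

lemma finite_indexI_cover:
  assumes "subgroup K G" and "subgroup H G" and "K \<subseteq> H" and "finite R" and "R \<subseteq> carrier G"
    and "\<And>h. h \<in> H \<Longrightarrow> \<exists>r\<in>R. \<exists>k\<in>K. h = r \<otimes> k"
  shows "finite_index G K H"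
proof -
  obtain f :: "'a \<Rightarrow> 'a" where f: "finite (f ` H)"
    "\<And>h h'. h \<in> H \<Longrightarrow> h' \<in> H \<Longrightarrow> f h = f h' \<Longrightarrow> inv h \<otimes> h' \<in> K"
    by (rule cover_by_left_cosetsE [OF assms(1,4-6)]) blast+
  show ?thesis by (rule finite_indexI [OF assms(1-3) f])
qed

lemma finite_index_refl: "subgroup H G \<Longrightarrow> finite_index G H H"
  by (rule finite_indexI [where f = "\<lambda>_. ()"])
    (simp_all add: subgroup.m_closed subgroup.m_inv_closed image_constant_conv)

lemma finite_index_Int:
  assumes 1: "finite_index G K H" and 2: "finite_index G L H"
  shows "finite_index G (K \<inter> L) H"
proof -
  have sub: "subgroup K G" "subgroup L G" "subgroup H G" "K \<subseteq> H"
    using assms by (auto simp: finite_index_def)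
  interpret K: subgroup K G by fact
  interpret L: subgroup L G by fact
  interpret H: subgroup H G by fact
  obtain Q where Q: "finite Q" "Q \<subseteq> H" "\<And>h. h \<in> H \<Longrightarrow> \<exists>r\<in>Q. \<exists>k\<in>K. h = r \<otimes> k"
    by (rule finite_indexD [OF 1]) blast
  obtain R where R: "finite R" "R \<subseteq> H" "\<And>h. h \<in> H \<Longrightarrow> \<exists>r\<in>R. \<exists>k\<in>L. h = r \<otimes> k"
    by (rule finite_indexD [OF 2]) blast
  have c: "Q \<subseteq> carrier G" "R \<subseteq> carrier G" using Q(2) R(2) H.subset by blast+
  obtain q :: "'a \<Rightarrow> 'a" where q: "finite (q ` H)"
    "\<And>h h'. h \<in> H \<Longrightarrow> h' \<in> H \<Longrightarrow> q h = q h' \<Longrightarrow> inv h \<otimes> h' \<in> K"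
    by (rule cover_by_left_cosetsE [OF sub(1) Q(1) c(1) Q(3)]) blast+
  obtain r :: "'a \<Rightarrow> 'a" where r: "finite (r ` H)"
    "\<And>h h'. h \<in> H \<Longrightarrow> h' \<in> H \<Longrightarrow> r h = r h' \<Longrightarrow> inv h \<otimes> h' \<in> L"
    by (rule cover_by_left_cosetsE [OF sub(2) R(1) c(2) R(3)]) blast+
  have "(\<lambda>h. (q h, r h)) ` H \<subseteq> q ` H \<times> r ` H" by blast
  then have "finite ((\<lambda>h. (q h, r h)) ` H)" using q(1) r(1) finite_subset by blast
  moreover have "K \<inter> L \<subseteq> H" using sub(4) by blast
  ultimately show ?thesis
    using q(2) r(2)
    by (intro finite_indexI [where f = "\<lambda>h. (q h, r h)"] subgroups_Inter_pair sub IntI) blast+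
qed

lemma finite_index_trans:
  assumes 1: "finite_index G K L" and 2: "finite_index G L H"
  shows "finite_index G K H"
proof -
  have sub: "subgroup K G" "subgroup L G" "subgroup H G" "K \<subseteq> L" "L \<subseteq> H"
    using assms by (auto simp: finite_index_def)
  interpret K: subgroup K G by fact
  interpret L: subgroup L G by fact
  interpret H: subgroup H G by fact
  obtain Q where Q: "finite Q" "Q \<subseteq> L" "\<And>h. h \<in> L \<Longrightarrow> \<exists>r\<in>Q. \<exists>k\<in>K. h = r \<otimes> k"
    by (rule finite_indexD [OF 1]) blast
  obtain R where R: "finite R" "R \<subseteq> H" "\<And>h. h \<in> H \<Longrightarrow> \<exists>r\<in>R. \<exists>k\<in>L. h = r \<otimes> k"
    by (rule finite_indexD [OF 2]) blast
  show ?thesis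
  proof (rule finite_indexI_cover [where R = "(\<lambda>(r, q). r \<otimes> q) ` (R \<times> Q)"])
    show "(\<lambda>(r, q). r \<otimes> q) ` (R \<times> Q) \<subseteq> carrier G"
      using Q(2) R(2) L.subset H.subset by (auto intro!: m_closed)
    fix h assume "h \<in> H"
    then obtain r l where rl: "r \<in> R" "l \<in> L" "h = r \<otimes> l" using R(3) by blast
    then obtain q k where qk: "q \<in> Q" "k \<in> K" "l = q \<otimes> k" using Q(3) by blast
    have "h = (r \<otimes> q) \<otimes> k" using rl(1,3) qk Q(2) R(2) by (auto simp: m_assoc subset_iff)
    then show "\<exists>r\<in>(\<lambda>(r, q). r \<otimes> q) ` (R \<times> Q). \<exists>k\<in>K. h = r \<otimes> k"
      using rl qk by blast
  qed (use sub Q(1) R(1) in auto)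
qed

lemma finite_index_conjugate_core:
  assumes X: "subgroup X G" and "finite F" and "F \<subseteq> carrier G"
    and fi: "\<And>c. c \<in> F \<Longrightarrow> finite_index G (X \<inter> conjugate_subgroup G c X) X"
  shows "finite_index G (X \<inter> conjugate_core G F X) X"
  using assms(2,3) fi
proof (induction F rule: finite_induct)
  case empty
  then show ?case using finite_index_refl [OF X] by (simp add: conjugate_core_def)
next
  case (insert c F)
  then have "finite_index G ((X \<inter> conjugate_core G F X) \<inter> (X \<inter> conjugate_subgroup G c X)) X"
    by (intro finite_index_Int [of "X \<inter> conjugate_core G F X"]) auto
  moreover have "(X \<inter> conjugate_core G F X) \<inter> (X \<inter> conjugate_subgroup G c X)
      = X \<inter> conjugate_core G (insert c F) X"
    by (auto simp: conjugate_core_def)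
  ultimately show ?case by simp
qed

text \<open>
  When \<open>V\<close> is open in a topological group, \<open>A\<close> is discrete and \<open>\<Delta>\<close> is cocompact. Two elements of \<open>A\<close> in the same piece \<open>V k \<Delta>\<close> can be corrected on
  the right by elements of \<open>\<Delta>\<close> so that they differ on the left by an element of \<open>A \<inter> V\<close>; so each piece
  meets a single left coset of \<open>\<Delta>\<close> in \<open>A\<close>.
\<close>

lemma finite_index_Int_if_discrete_cocompact:
  assumes A: "subgroup A G" and V: "subgroup V G" "A \<inter> V \<subseteq> {\<one>}"
    and \<Delta>: "subgroup \<Delta> G" "\<Delta> \<subseteq> A" and B: "subgroup B G" "B \<subseteq> A"
    and Q: "finite Q" "Q \<subseteq> carrier G"
    and cov: "\<And>g. g \<in> carrier G \<Longrightarrow> \<exists>v\<in>V. \<exists>k\<in>Q. \<exists>\<delta>\<in>\<Delta>. g = v \<otimes> k \<otimes> \<delta>"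
  shows "finite_index G (B \<inter> \<Delta>) B"
proof -
  interpret A: subgroup A G by fact
  interpret B: subgroup B G by fact
  interpret V: subgroup V G by fact
  interpret D: subgroup \<Delta> G by fact
  obtain f where f: "\<And>g. g \<in> carrier G \<Longrightarrow> f g \<in> Q"
      "\<And>g. g \<in> carrier G \<Longrightarrow> \<exists>v\<in>V. \<exists>\<delta>\<in>\<Delta>. g = v \<otimes> f g \<otimes> \<delta>"
    using cov by metis
  show ?thesis
  proof (rule finite_indexI [where f = f])
    show "finite (f ` B)"
      using f(1) Q(1) B.subset by (meson finite_subset image_subsetI subsetD)
    fix g h assume gh: "g \<in> B" "h \<in> B" "f g = f h"
    define k where "k = f g"
    have k: "k \<in> carrier G" using f(1) [of g] gh(1) Q(2) by (auto simp: k_def)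
    obtain v \<delta> where v: "v \<in> V" "\<delta> \<in> \<Delta>" "g = v \<otimes> k \<otimes> \<delta>"
      using f(2) [of g] gh(1) unfolding k_def by auto
    obtain w \<epsilon> where w: "w \<in> V" "\<epsilon> \<in> \<Delta>" "h = w \<otimes> k \<otimes> \<epsilon>"
      using f(2) [of h] gh(2,3) unfolding k_def by auto
    have g': "g \<otimes> inv \<delta> = v \<otimes> k"
      by (subst v(3)) (use v(1,2) k in \<open>simp add: m_assoc\<close>)
    have h': "h \<otimes> inv \<epsilon> = w \<otimes> k"
      by (subst w(3)) (use w(1,2) k in \<open>simp add: m_assoc\<close>)
    have inA: "g \<otimes> inv \<delta> \<in> A" "h \<otimes> inv \<epsilon> \<in> A"
      using gh(1,2) v(2) w(2) \<Delta>(2) B(2) by auto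
    have "(g \<otimes> inv \<delta>) \<otimes> inv (h \<otimes> inv \<epsilon>) = v \<otimes> inv w"
      unfolding g' h' using v(1) w(1) k by (intro mult_inv_cancel_right) auto
    then have "(g \<otimes> inv \<delta>) \<otimes> inv (h \<otimes> inv \<epsilon>) \<in> A \<inter> V"
      using inA v(1) w(1) by (metis A.m_closed A.m_inv_closed IntI V.m_closed V.m_inv_closed)
    then have "(g \<otimes> inv \<delta>) \<otimes> inv (h \<otimes> inv \<epsilon>) = \<one>" using V(2) by blast
    then have "g \<otimes> inv \<delta> = h \<otimes> inv \<epsilon>"
      using inA by (metis A.mem_carrier inv_closed inv_equality inv_inv)
    moreover define a where "a = g \<otimes> inv \<delta>"
    ultimately have a: "a = g \<otimes> inv \<delta>" "a = h \<otimes> inv \<epsilon>" by simp_all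
    have "g = a \<otimes> \<delta>" unfolding a(1) using gh(1) v(2) by (simp add: m_assoc)
    moreover have "h = a \<otimes> \<epsilon>" unfolding a(2) using gh(2) w(2) by (simp add: m_assoc)
    moreover have "a \<in> carrier G" using inA(1) by (simp add: a_def)
    ultimately have "inv g \<otimes> h = inv \<delta> \<otimes> \<epsilon>"
      using inv_mult_cancel_left [of a \<delta> \<epsilon>] v(2) w(2) by simp
    then have "inv g \<otimes> h \<in> \<Delta>" using v(2) w(2) by simp
    then show "inv g \<otimes> h \<in> B \<inter> \<Delta>" using gh(1,2) by simp
  qed (use B \<Delta> in \<open>auto intro: subgroups_Inter_pair\<close>)
qed

lemma finitely_generated_Un:
  assumes "finitely_generated_subgroup G X" "finitely_generated_subgroup G Y"
  shows "finitely_generated_subgroup G (generate G (X \<union> Y))"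
proof -
  obtain S where S: "finite S" "S \<subseteq> carrier G" "X = generate G S"
    using assms(1) by (auto simp: finitely_generated_subgroup_def)
  obtain R where R: "finite R" "R \<subseteq> carrier G" "Y = generate G R"
    using assms(2) by (auto simp: finitely_generated_subgroup_def)
  have SR: "S \<union> R \<subseteq> carrier G" using S R by simp
  have "generate G (X \<union> Y) = generate G (S \<union> R)"
  proof
    have "X \<union> Y \<subseteq> generate G (S \<union> R)"
      unfolding S(3) R(3) using mono_generate [of S "S \<union> R"] mono_generate [of R "S \<union> R"] by simp
    then show "generate G (X \<union> Y) \<subseteq> generate G (S \<union> R)"
      using generate_is_subgroup [OF SR] by (rule generate_subgroup_incl)
    have "S \<union> R \<subseteq> X \<union> Y" unfolding S(3) R(3) by (auto intro: generate.incl)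
    then show "generate G (S \<union> R) \<subseteq> generate G (X \<union> Y)" by (rule mono_generate)
  qed
  then show ?thesis
    unfolding finitely_generated_subgroup_def using S(1) R(1) SR by blast
qed

text \<open>
  Induction on words, appending one letter on the right at a time; the inductive definition of
  \<open>generate\<close> multiplies two arbitrary elements instead.
\<close>

lemma generate_right_closed:
  assumes S: "S \<subseteq> carrier G" and Y: "Y \<subseteq> carrier G" and "\<one> \<in> Y"
    and step: "\<And>y s. y \<in> Y \<Longrightarrow> s \<in> S \<Longrightarrow> y \<otimes> s \<in> Y"
    and step_inv: "\<And>y s. y \<in> Y \<Longrightarrow> s \<in> S \<Longrightarrow> y \<otimes> inv s \<in> Y"
  shows "generate G S \<subseteq> Y"
proof
  fix x assume x: "x \<in> generate G S"
  have "\<forall>y\<in>Y. y \<otimes> x \<in> Y"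
    using x
  proof (induction rule: generate.induct)
    case one
    then show ?case using Y by (auto simp: subset_iff)
  next
    case (eng h1 h2)
    then have "h1 \<in> carrier G" "h2 \<in> carrier G"
      using generate_in_carrier [OF S] by auto
    then show ?case using eng Y by (auto simp: m_assoc [symmetric] subset_iff)
  qed (use step step_inv in auto)
  then show "x \<in> Y"
    using \<open>\<one> \<in> Y\<close> generate_in_carrier [OF S x] by (auto dest: bspec [where x = \<one>])
qed

text \<open>
  \<open>P\<close> acts on \<open>P / \<Gamma>\<close>. Joining \<open>p\<Gamma>\<close> to the cosets contained in \<open>p\<Gamma>s\<Gamma>\<close>, for \<open>s\<close> in a
  finite generating set, gives a connected graph, locally finite because \<open>P\<close> commensurates \<open>\<Gamma>\<close>.
  The double coset hypothesis says that \<open>P \<inter> U\<close> has finitely many orbits on its vertices, and the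
  last hypothesis that only finitely many elements of \<open>U\<close> move the vertex \<open>\<Gamma>\<close> to a given vertex. So
  \<open>P \<inter> U\<close> is generated by finitely many elements: those that carry chosen representatives to the
  neighbours of other representatives, and those that carry \<open>\<Gamma>\<close> to a representative.
\<close>

lemma finitely_generated_Int:
  assumes U: "subgroup U G" and \<Gamma>: "subgroup \<Gamma> G" and P: "finitely_generated_subgroup G P"
    and "\<Gamma> \<subseteq> P"
    and fi: "\<And>p. p \<in> P \<Longrightarrow> finite_index G (\<Gamma> \<inter> conjugate_subgroup G p \<Gamma>) \<Gamma>"
    and "finite Q" and Qc: "Q \<subseteq> carrier G"
    and cov: "\<And>p. p \<in> P \<Longrightarrow> \<exists>u\<in>U. \<exists>k\<in>Q. \<exists>\<gamma>\<in>\<Gamma>. p = u \<otimes> k \<otimes> \<gamma>"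
    and fin: "\<And>p. p \<in> P \<Longrightarrow> finite {\<gamma> \<in> \<Gamma>. p \<otimes> \<gamma> \<in> U}"
  shows "finitely_generated_subgroup G (P \<inter> U)"
proof -
  interpret U: subgroup U G by fact
  interpret \<Gamma>: subgroup \<Gamma> G by fact
  obtain S where S: "finite S" "S \<subseteq> carrier G" "P = generate G S"
    using P by (auto simp: finitely_generated_subgroup_def)
  have Ps: "subgroup P G" using S generate_is_subgroup by simp
  interpret P: subgroup P G by fact
  define L where "L = P \<inter> U"
  have L: "subgroup L G" unfolding L_def using Ps U by (rule subgroups_Inter_pair)
  interpret L: subgroup L G by fact
  \<comment> \<open>Replace the representatives in \<open>Q\<close> by representatives \<open>R\<close> lying in \<open>P\<close>, which turns
    the factor from \<open>U\<close> into one from \<open>P \<inter> U\<close>.\<close>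
  define k where "k p = (SOME k. k \<in> Q \<and> (\<exists>u\<in>U. \<exists>\<gamma>\<in>\<Gamma>. p = u \<otimes> k \<otimes> \<gamma>))" for p
  have k: "k p \<in> Q" "\<exists>u\<in>U. \<exists>\<gamma>\<in>\<Gamma>. p = u \<otimes> k p \<otimes> \<gamma>" if "p \<in> P" for p
    using someI_ex [of "\<lambda>k. k \<in> Q \<and> (\<exists>u\<in>U. \<exists>\<gamma>\<in>\<Gamma>. p = u \<otimes> k \<otimes> \<gamma>)"] cov [OF that]
    unfolding k_def by blast+
  have "finite (k ` P)" using k(1) \<open>finite Q\<close> by (meson finite_subset image_subsetI)
  then obtain R0 where R0: "finite R0" "R0 \<subseteq> P" "k ` P = k ` R0"
    using finite_subset_image [of "k ` P" k P] by auto
  define R where "R = insert \<one> R0"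
  have R: "finite R" "R \<subseteq> P" "\<one> \<in> R" using R0 by (auto simp: R_def)
  have dec: "\<exists>l\<in>L. \<exists>r\<in>R. \<exists>\<gamma>\<in>\<Gamma>. p = l \<otimes> r \<otimes> \<gamma>" if p: "p \<in> P" for p
  proof -
    obtain r where r: "r \<in> R0" "k p = k r" using R0(3) p by blast
    then have "r \<in> P" using R0 by auto
    obtain u \<gamma> where u: "u \<in> U" "\<gamma> \<in> \<Gamma>" "p = u \<otimes> k r \<otimes> \<gamma>" using k(2) [OF p] r by metis
    obtain u' \<gamma>' where u': "u' \<in> U" "\<gamma>' \<in> \<Gamma>" "r = u' \<otimes> k r \<otimes> \<gamma>'"
      using k(2) [OF \<open>r \<in> P\<close>] by metis
    have c: "k r \<in> carrier G" "r \<in> carrier G" "p \<in> carrier G"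
      using k(1) [OF \<open>r \<in> P\<close>] Qc \<open>r \<in> P\<close> p by auto
    have g: "u \<in> carrier G" "u' \<in> carrier G" "\<gamma> \<in> carrier G" "\<gamma>' \<in> carrier G"
      using u u' by auto
    define a where "a = p \<otimes> inv \<gamma>"
    define b where "b = r \<otimes> inv \<gamma>'"
    have ab: "a \<in> P" "b \<in> P"
      using p \<open>r \<in> P\<close> u(2) u'(2) \<open>\<Gamma> \<subseteq> P\<close> by (auto simp: a_def b_def)
    have "a = u \<otimes> k r"
      unfolding a_def by (subst u(3)) (use c(1) g in \<open>simp add: m_assoc\<close>)
    moreover have "b = u' \<otimes> k r"
      unfolding b_def by (subst u'(3)) (use c(1) g in \<open>simp add: m_assoc\<close>)
    ultimately have "a \<otimes> inv b = u \<otimes> inv u'"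
      using g c(1) by (simp add: mult_inv_cancel_right)
    then have "a \<otimes> inv b \<in> U" using u(1) u'(1) by simp
    then have "a \<otimes> inv b \<in> L" using ab by (simp add: L_def)
    moreover have "p = (a \<otimes> inv b) \<otimes> r \<otimes> (inv \<gamma>' \<otimes> \<gamma>)"
    proof -
      have abc: "a \<in> carrier G" "b \<in> carrier G" using ab by auto
      have "(a \<otimes> inv b) \<otimes> r \<otimes> (inv \<gamma>' \<otimes> \<gamma>) = (a \<otimes> inv b) \<otimes> (b \<otimes> \<gamma>)"
        using abc c g by (simp add: m_assoc b_def [symmetric] del: inv_mult_group) (simp add: b_def m_assoc)
      also have "\<dots> = a \<otimes> ((inv b \<otimes> b) \<otimes> \<gamma>)"
        using abc g by (simp only: m_assoc inv_closed m_closed)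
      also have "\<dots> = a \<otimes> \<gamma>" using abc g by simp
      also have "\<dots> = p" unfolding a_def using c g by (simp add: m_assoc)
      finally show ?thesis by simp
    qed
    moreover have "inv \<gamma>' \<otimes> \<gamma> \<in> \<Gamma>" using u u' by simp
    moreover have "r \<in> R" using r by (simp add: R_def)
    ultimately show ?thesis by blast
  qed
  define S' where "S' = S \<union> m_inv G ` S"
  have S': "finite S'" "S' \<subseteq> P"
    using S by (auto simp: S'_def generate.incl generate.inv)
  have "\<exists>J. finite J \<and> J \<subseteq> \<Gamma> \<and> (\<forall>\<gamma>\<in>\<Gamma>. \<exists>j\<in>J. \<exists>\<delta>\<in>\<Gamma> \<inter> conjugate_subgroup G s \<Gamma>. \<gamma> = j \<otimes> \<delta>)"
    if "s \<in> S'" for s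
    using finite_indexD [OF fi, of s] that S' by (metis subsetD)
  then obtain J where J: "\<And>s. s \<in> S' \<Longrightarrow> finite (J s) \<and> J s \<subseteq> \<Gamma> \<and>
      (\<forall>\<gamma>\<in>\<Gamma>. \<exists>j\<in>J s. \<exists>\<delta>\<in>\<Gamma> \<inter> conjugate_subgroup G s \<Gamma>. \<gamma> = j \<otimes> \<delta>)"
    by metis
  \<comment> \<open>\<open>M\<close> represents all neighbours of the orbit representatives.\<close>
  define M where "M = (\<Union>s\<in>S'. (\<lambda>(r, j). r \<otimes> j \<otimes> s) ` (R \<times> J s))"
  have M: "finite M" using S' J R by (auto simp: M_def)
  have "M \<subseteq> P"
  proof
    fix m assume "m \<in> M"
    then obtain s r j where m: "s \<in> S'" "r \<in> R" "j \<in> J s" "m = r \<otimes> j \<otimes> s"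
      by (auto simp: M_def)
    then have "j \<in> P" "s \<in> P" "r \<in> P" using J [of s] S' R \<open>\<Gamma> \<subseteq> P\<close> by auto
    then show "m \<in> P" using m(4) by simp
  qed
  obtain l where l: "\<And>p. p \<in> P \<Longrightarrow> l p \<in> L \<and> (\<exists>r\<in>R. \<exists>\<gamma>\<in>\<Gamma>. p = l p \<otimes> r \<otimes> \<gamma>)"
    using dec by metis
  define X where "X = l ` M \<union> (\<Union>r\<in>R. (\<lambda>\<gamma>. r \<otimes> \<gamma>) ` {\<gamma> \<in> \<Gamma>. r \<otimes> \<gamma> \<in> U})"
  have X: "finite X" using M R fin by (auto simp: X_def subset_iff)
  have XL: "X \<subseteq> L"
    using l \<open>M \<subseteq> P\<close> R \<open>\<Gamma> \<subseteq> P\<close> by (auto simp: X_def L_def subset_iff)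
  then have Xc: "X \<subseteq> carrier G" using L.subset by auto
  define Z where "Z = generate G X"
  have Z: "subgroup Z G" unfolding Z_def by (rule generate_is_subgroup [OF Xc])
  interpret Z: subgroup Z G by fact
  have ZL: "Z \<subseteq> L" unfolding Z_def using generate_subgroup_incl [OF XL L] .
  \<comment> \<open>The union of the \<open>Z\<close>-orbits of the representatives is closed under passing to neighbours,
    so it is all of \<open>P\<close>.\<close>
  define Y where "Y = {z \<otimes> r \<otimes> \<gamma> | z r \<gamma>. z \<in> Z \<and> r \<in> R \<and> \<gamma> \<in> \<Gamma>}"
  have Rc: "r \<in> carrier G" if "r \<in> R" for r using that R by auto
  have Y: "y \<otimes> s \<in> Y" if y: "y \<in> Y" and s: "s \<in> S'" for y s
  proof -
    obtain z r \<gamma> where zr: "z \<in> Z" "r \<in> R" "\<gamma> \<in> \<Gamma>" "y = z \<otimes> r \<otimes> \<gamma>"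
      using y by (auto simp: Y_def)
    have sc: "s \<in> carrier G" using s S' by auto
    obtain j \<delta> where j: "j \<in> J s" "\<delta> \<in> \<Gamma>" "\<delta> \<in> conjugate_subgroup G s \<Gamma>" "\<gamma> = j \<otimes> \<delta>"
      using J [OF s] zr(3) by blast
    have d: "inv s \<otimes> \<delta> \<otimes> s \<in> \<Gamma>" using j(3) sc by (simp add: mem_conjugate_subgroup \<Gamma>.subset)
    have "j \<in> \<Gamma>" using j J [OF s] by auto
    have m: "r \<otimes> j \<otimes> s \<in> M" using j zr s by (auto simp: M_def)
    then obtain r' \<gamma>' where r': "r' \<in> R" "\<gamma>' \<in> \<Gamma>"
      "r \<otimes> j \<otimes> s = l (r \<otimes> j \<otimes> s) \<otimes> r' \<otimes> \<gamma>'"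
      using l \<open>M \<subseteq> P\<close> by blast
    define a where "a = l (r \<otimes> j \<otimes> s)"
    have "a \<in> X" using m by (auto simp: X_def a_def)
    then have a: "a \<in> Z" by (simp add: Z_def generate.incl)
    have "y \<otimes> s = z \<otimes> (r \<otimes> j \<otimes> s) \<otimes> (inv s \<otimes> \<delta> \<otimes> s)"
    proof -
      have "\<delta> \<otimes> s = s \<otimes> (inv s \<otimes> \<delta> \<otimes> s)"
        using j(2) sc by (simp add: m_assoc [symmetric])
      then show ?thesis
        using zr j(2,4) \<open>j \<in> \<Gamma>\<close> sc Rc by (simp add: m_assoc)
    qed
    also have "\<dots> = z \<otimes> (a \<otimes> r' \<otimes> \<gamma>') \<otimes> (inv s \<otimes> \<delta> \<otimes> s)"
      using r'(3) by (simp add: a_def)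
    also have "\<dots> = (z \<otimes> a) \<otimes> r' \<otimes> (\<gamma>' \<otimes> (inv s \<otimes> \<delta> \<otimes> s))"
      using zr(1) a r' Rc \<Gamma>.mem_carrier [OF d] by (simp add: m_assoc del: \<Gamma>.mem_carrier inv_closed) (simp add: m_assoc sc j(2))
    finally show ?thesis
      using zr(1) a r' d unfolding Y_def by blast
  qed
  have "P \<subseteq> Y"
    unfolding S(3)
  proof (rule generate_right_closed)
    show "Y \<subseteq> carrier G" using Rc by (auto simp: Y_def)
    have "\<one> = \<one> \<otimes> \<one> \<otimes> \<one>" by simp
    then show "\<one> \<in> Y" unfolding Y_def using R(3) Z.one_closed \<Gamma>.one_closed by blast
  qed (use S(2) Y in \<open>auto simp: S'_def\<close>)
  have "L \<subseteq> Z"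
  proof
    fix x assume x: "x \<in> L"
    then obtain z r \<gamma> where z: "z \<in> Z" "r \<in> R" "\<gamma> \<in> \<Gamma>" "x = z \<otimes> r \<otimes> \<gamma>"
      using \<open>P \<subseteq> Y\<close> by (auto simp: L_def Y_def)
    have x': "x = z \<otimes> (r \<otimes> \<gamma>)" using z Rc by (simp add: m_assoc)
    then have "r \<otimes> \<gamma> = inv z \<otimes> x" using z Rc by (simp add: m_assoc [symmetric])
    moreover have "inv z \<in> L" using z(1) ZL by auto
    ultimately have "r \<otimes> \<gamma> \<in> U" using x by (auto simp: L_def)
    then have "r \<otimes> \<gamma> \<in> X" using z by (auto simp: X_def)
    then have "r \<otimes> \<gamma> \<in> Z" by (simp add: Z_def generate.incl)
    then show "x \<in> Z" using x' z by simp
  qed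
  then have "P \<inter> U = generate G X" using ZL by (auto simp: L_def Z_def)
  then show ?thesis
    unfolding finitely_generated_subgroup_def using X Xc by blast
qed

end

section \<open>Topological groups and cocompact lattices\<close>

text \<open>
  The compactness principle used twice below: a directed family of closed sets that enters an open set
  \<open>W\<close> in the limit, within a compact set, has already entered \<open>W\<close> at some member.
\<close>

lemma compactin_directed_Inter:
  assumes K: "compactin T K" and cl: "\<And>A. A \<in> \<A> \<Longrightarrow> closedin T A" and ne: "\<A> \<noteq> {}"
    and dir: "\<And>A B. A \<in> \<A> \<Longrightarrow> B \<in> \<A> \<Longrightarrow> \<exists>D\<in>\<A>. D \<subseteq> A \<inter> B"
    and W: "openin T W" and sub: "K \<inter> \<Inter>\<A> \<subseteq> W"
  shows "\<exists>A\<in>\<A>. K \<inter> A \<subseteq> W"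
proof (rule ccontr)
  assume contra: "\<not> ?thesis"
  have "compactin T (K \<inter> (topspace T - W))"
    using K W by (intro compact_Int_closedin) auto
  then have fip: "\<forall>\<U>. (\<forall>C\<in>\<U>. closedin T C) \<and>
      (\<forall>\<F>. finite \<F> \<and> \<F> \<subseteq> \<U> \<longrightarrow> K \<inter> (topspace T - W) \<inter> \<Inter>\<F> \<noteq> {}) \<longrightarrow>
      K \<inter> (topspace T - W) \<inter> \<Inter>\<U> \<noteq> {}"
    unfolding compactin_fip by (rule conjunct2)
  have nonempty: "K \<inter> (topspace T - W) \<inter> \<Inter>\<F> \<noteq> {}" if "finite \<F>" "\<F> \<subseteq> \<A>" for \<F>
  proof -
    have "\<exists>D\<in>\<A>. D \<subseteq> \<Inter>\<F>"
      using that
    proof (induction \<F> rule: finite_induct)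
      case empty
      then show ?case using ne by auto
    next
      case (insert A \<F>)
      then obtain D where D: "D \<in> \<A>" "D \<subseteq> \<Inter>\<F>" by auto
      moreover have "A \<in> \<A>" using insert.prems by simp
      ultimately obtain B where "B \<in> \<A>" "B \<subseteq> A \<inter> D" using dir [of A D] by metis
      then show ?case using D(2) by (intro bexI [of _ B]) auto
    qed
    then obtain D where D: "D \<in> \<A>" "D \<subseteq> \<Inter>\<F>" by blast
    then have "\<not> K \<inter> D \<subseteq> W" using contra by blast
    moreover have "K \<subseteq> topspace T" using K by (rule compactin_subset_topspace)
    ultimately show ?thesis using D(2) by blast
  qed
  have "K \<inter> (topspace T - W) \<inter> \<Inter>\<A> \<noteq> {}"
    by (rule fip [rule_format]) (use cl nonempty in simp_all)
  then show False using sub by blast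
qed

lemma discrete_subset_isolated:
  assumes "discrete_subset T S" "x \<in> S"
  obtains W where "openin T W" "W \<inter> S = {x}"
proof -
  have "openin (subtopology T S) {x}"
    using assms by (simp add: discrete_subset_def)
  then show thesis using that by (auto simp: openin_subtopology)
qed

context topological_group
begin

lemma continuous_mult_maps:
  assumes "continuous_map X T f" "continuous_map X T g"
  shows "continuous_map X T (\<lambda>x. f x \<otimes> g x)"
  using continuous_map_compose [OF continuous_map_pairedI [OF assms] continuous_mult]
  by (simp add: o_def)

lemma continuous_inv_map:
  assumes "continuous_map X T f"
  shows "continuous_map X T (\<lambda>x. inv (f x))"
  using continuous_map_compose [OF assms continuous_inv] by (simp add: o_def)

lemma continuous_const: "a \<in> carrier G \<Longrightarrow> continuous_map X T (\<lambda>_. a)"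
  by (simp add: topspace_eq_carrier)

lemma continuous_id: "continuous_map T T (\<lambda>x. x)"
  using continuous_map_id by (simp add: id_def)

lemmas continuous_group_intros =
  continuous_mult_maps continuous_inv_map continuous_const continuous_id

lemma openin_preimage:
  "continuous_map T T f \<Longrightarrow> openin T W \<Longrightarrow> openin T {x \<in> carrier G. f x \<in> W}"
  using openin_continuous_map_preimage [of T T f W] by (simp add: topspace_eq_carrier)

lemma closedin_preimage:
  "continuous_map T T f \<Longrightarrow> closedin T W \<Longrightarrow> closedin T {x \<in> carrier G. f x \<in> W}"
  using closedin_continuous_map_preimage [of T T f W] by (simp add: topspace_eq_carrier)

text \<open>
  Continuity arguments on dense subsets all take this form: a closed condition that holds on \<open>S\<close>
  holds on its closure.
\<close>

lemma closure_subset_preimage: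
  assumes "continuous_map T T f" "closedin T W" "S \<subseteq> carrier G" "\<And>x. x \<in> S \<Longrightarrow> f x \<in> W"
  shows "x \<in> T closure_of S \<Longrightarrow> f x \<in> W"
  using closure_of_minimal [OF _ closedin_preimage [OF assms(1,2)], of S] assms(3,4) by blast

lemma closure_carrier: "T closure_of S \<subseteq> carrier G"
  using closure_of_subset_topspace [of T S] by (simp add: topspace_eq_carrier)

lemma subset_closure: "S \<subseteq> carrier G \<Longrightarrow> S \<subseteq> T closure_of S"
  by (simp add: closure_of_subset topspace_eq_carrier)

lemma subgroup_closure:
  assumes "subgroup P G"
  shows "subgroup (T closure_of P) G"
proof -
  interpret P: subgroup P G by fact
  let ?A = "T closure_of P"
  have PA: "P \<subseteq> ?A" using subset_closure P.subset by blast
  have Ac: "a \<in> carrier G" if "a \<in> ?A" for a using that closure_carrier by blast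
  have 1: "p \<otimes> a \<in> ?A" if "p \<in> P" "a \<in> ?A" for p a
    by (rule closure_subset_preimage [where f = "\<lambda>x. p \<otimes> x", OF _ _ P.subset _ that(2)])
      (use that PA in \<open>auto intro!: continuous_group_intros\<close>)
  have 2: "b \<otimes> a \<in> ?A" if "b \<in> ?A" "a \<in> ?A" for a b
    by (rule closure_subset_preimage [where f = "\<lambda>x. x \<otimes> a", OF _ _ P.subset _ that(1)])
      (use that 1 Ac in \<open>auto intro!: continuous_group_intros\<close>)
  have 3: "inv a \<in> ?A" if "a \<in> ?A" for a
    by (rule closure_subset_preimage [where f = "\<lambda>x. inv x", OF _ _ P.subset _ that])
      (use PA in \<open>auto intro!: continuous_group_intros\<close>)
  have "\<one> \<in> ?A" using PA by auto
  then show ?thesis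
    using closure_carrier 2 3 by (intro subgroupI) auto
qed

lemma finite_cover_compact:
  assumes K: "compactin T K" and V: "subgroup V G" "openin T V"
  obtains R where "finite R" "R \<subseteq> carrier G" "\<And>x. x \<in> K \<Longrightarrow> \<exists>r\<in>R. \<exists>v\<in>V. x = r \<otimes> v"
proof -
  interpret V: subgroup V G by fact
  define B where "B k = {x \<in> carrier G. inv k \<otimes> x \<in> V}" for k
  have Kc: "K \<subseteq> carrier G" using compactin_subset_topspace [OF K] topspace_eq_carrier by simp
  have "openin T (B k)" if "k \<in> K" for k
    unfolding B_def using that Kc V(2) by (intro openin_preimage continuous_group_intros) auto
  moreover have "k \<in> B k" if "k \<in> K" for k
    using that Kc by (auto simp: B_def)
  ultimately obtain \<F> where F: "finite \<F>" "\<F> \<subseteq> B ` K" "K \<subseteq> \<Union>\<F>"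
    using compactinD [OF K, of "B ` K"] by blast
  obtain R where R: "finite R" "R \<subseteq> K" "\<F> = B ` R"
    using finite_subset_image [OF F(1,2)] by blast
  show thesis
  proof
    fix x assume "x \<in> K"
    then obtain r where r: "r \<in> R" "inv r \<otimes> x \<in> V" "x \<in> carrier G"
      using F(3) R(3) by (auto simp: B_def)
    moreover have "x = r \<otimes> (inv r \<otimes> x)"
      using r R(2) Kc by (auto simp: m_assoc [symmetric])
    ultimately show "\<exists>r\<in>R. \<exists>v\<in>V. x = r \<otimes> v" by blast
  qed (use R Kc in auto)
qed

text \<open>
  The translates \<open>Vk\<close> have open images in the compact space of left cosets of \<open>\<Gamma>\<close>, so finitely many
  of these images cover it.
\<close>

lemma finite_double_cosets:
  assumes \<Gamma>: "subgroup \<Gamma> G" and cpt: "compact_space (coset_topology G T \<Gamma>)"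
    and V: "subgroup V G" "openin T V"
  obtains Q where "finite Q" "Q \<subseteq> carrier G"
    "\<And>g. g \<in> carrier G \<Longrightarrow> \<exists>v\<in>V. \<exists>k\<in>Q. \<exists>\<gamma>\<in>\<Gamma>. g = v \<otimes> k \<otimes> \<gamma>"
proof -
  interpret V: subgroup V G by fact
  interpret \<Gamma>: subgroup \<Gamma> G by fact
  define B where "B k = (\<lambda>v. (v \<otimes> k) <# \<Gamma>) ` V" for k
  have coset: "g <# \<Gamma> = h <# \<Gamma> \<longleftrightarrow> (\<exists>\<gamma>\<in>\<Gamma>. g = h \<otimes> \<gamma>)"
    if "g \<in> carrier G" "h \<in> carrier G" for g h
  proof
    assume "g <# \<Gamma> = h <# \<Gamma>"
    then have "g \<in> h <# \<Gamma>" using that(1) \<Gamma>.one_closed by (force simp: l_coset_def)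
    then show "\<exists>\<gamma>\<in>\<Gamma>. g = h \<otimes> \<gamma>" by (auto simp: l_coset_def)
  next
    assume "\<exists>\<gamma>\<in>\<Gamma>. g = h \<otimes> \<gamma>"
    then have "g \<in> h <# \<Gamma>" by (auto simp: l_coset_def)
    then show "g <# \<Gamma> = h <# \<Gamma>" using l_repr_independence [OF _ that(2) \<Gamma>] by simp
  qed
  have "openin (coset_topology G T \<Gamma>) (B k)" if k: "k \<in> carrier G" for k
  proof -
    have mem: "g <# \<Gamma> \<in> B k \<longleftrightarrow> (\<exists>\<gamma>\<in>\<Gamma>. g \<otimes> inv (k \<otimes> \<gamma>) \<in> V)" if g: "g \<in> carrier G" for g
    proof
      assume "g <# \<Gamma> \<in> B k"
      then obtain v where v: "v \<in> V" "g <# \<Gamma> = (v \<otimes> k) <# \<Gamma>" by (auto simp: B_def)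
      then obtain \<gamma> where \<gamma>: "\<gamma> \<in> \<Gamma>" "g = v \<otimes> k \<otimes> \<gamma>" using coset g k by auto
      then have "g \<otimes> inv (k \<otimes> \<gamma>) = v"
        using v k by (simp add: m_assoc del: inv_mult_group)
      then show "\<exists>\<gamma>\<in>\<Gamma>. g \<otimes> inv (k \<otimes> \<gamma>) \<in> V" using v \<gamma> by blast
    next
      assume "\<exists>\<gamma>\<in>\<Gamma>. g \<otimes> inv (k \<otimes> \<gamma>) \<in> V"
      then obtain \<gamma> where \<gamma>: "\<gamma> \<in> \<Gamma>" "g \<otimes> inv (k \<otimes> \<gamma>) \<in> V" by blast
      have "g = (g \<otimes> inv (k \<otimes> \<gamma>)) \<otimes> (k \<otimes> \<gamma>)"
        using g k \<gamma> by (simp add: m_assoc del: inv_mult_group)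
      then have "g = (g \<otimes> inv (k \<otimes> \<gamma>)) \<otimes> k \<otimes> \<gamma>"
        using g k \<gamma> by (simp add: m_assoc)
      then have "g <# \<Gamma> = ((g \<otimes> inv (k \<otimes> \<gamma>)) \<otimes> k) <# \<Gamma>"
        using coset g k \<gamma> by auto
      then show "g <# \<Gamma> \<in> B k" using \<gamma>(2) by (auto simp: B_def)
    qed
    then have "{g \<in> topspace T. g <# \<Gamma> \<in> B k}
        = (\<Union>\<gamma>\<in>\<Gamma>. {g \<in> carrier G. g \<otimes> inv (k \<otimes> \<gamma>) \<in> V})"
      by (auto simp: topspace_eq_carrier)
    moreover have "openin T \<dots>"
      using k V(2) by (intro openin_Union) (auto intro!: openin_preimage continuous_group_intros)
    moreover have "B k \<subseteq> left_cosets G \<Gamma>" using k by (auto simp: B_def left_cosets_def)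
    ultimately show ?thesis by (simp add: openin_coset_topology)
  qed
  moreover have "\<Union>(B ` carrier G) = left_cosets G \<Gamma>"
  proof
    show "\<Union>(B ` carrier G) \<subseteq> left_cosets G \<Gamma>" by (auto simp: B_def left_cosets_def)
    have "k <# \<Gamma> \<in> B k" if "k \<in> carrier G" for k
      unfolding B_def using that by (intro image_eqI [of _ _ \<one>]) auto
    then show "left_cosets G \<Gamma> \<subseteq> \<Union>(B ` carrier G)" by (auto simp: left_cosets_def)
  qed
  ultimately obtain \<F> where F: "finite \<F>" "\<F> \<subseteq> B ` carrier G" "\<Union>\<F> = left_cosets G \<Gamma>"
    using cpt unfolding compact_space topspace_coset_topology
    by (metis (no_types, lifting) imageE)
  obtain Q where Q: "finite Q" "Q \<subseteq> carrier G" "\<F> = B ` Q"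
    using finite_subset_image [OF F(1,2)] by blast
  show thesis
  proof
    fix g assume g: "g \<in> carrier G"
    then have "g <# \<Gamma> \<in> \<Union>(B ` Q)" using F(3) Q(3) by (auto simp: left_cosets_def)
    then obtain k v where kv: "k \<in> Q" "v \<in> V" "g <# \<Gamma> = (v \<otimes> k) <# \<Gamma>" by (auto simp: B_def)
    then have "v \<otimes> k \<in> carrier G" using Q(2) by auto
    then show "\<exists>v\<in>V. \<exists>k\<in>Q. \<exists>\<gamma>\<in>\<Gamma>. g = v \<otimes> k \<otimes> \<gamma>"
      using coset [OF g] kv by blast
  qed (use Q in auto)
qed

lemma openin_conjugate_core:
  assumes U: "subgroup U G" "openin T U" and F: "finite F" "F \<noteq> {}" "F \<subseteq> carrier G"
  shows "openin T (conjugate_core G F U)"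
proof -
  interpret U: subgroup U G by fact
  have "openin T (conjugate_subgroup G c U)" if c: "c \<in> carrier G" for c
  proof -
    have "conjugate_subgroup G c U = {x \<in> carrier G. inv c \<otimes> x \<otimes> c \<in> U}"
      using mem_conjugate_subgroup [OF U.subset c] by blast
    then show ?thesis
      using c U(2) by (auto intro!: openin_preimage continuous_group_intros)
  qed
  then show ?thesis
    using F by (auto simp: conjugate_core_def intro!: openin_Inter)
qed

lemma closedin_conjugate_core:
  assumes U: "subgroup U G" "closedin T U" and F: "F \<noteq> {}" "F \<subseteq> carrier G"
  shows "closedin T (conjugate_core G F U)"
proof -
  interpret U: subgroup U G by fact
  have "closedin T (conjugate_subgroup G c U)" if c: "c \<in> carrier G" for c
  proof -
    have "conjugate_subgroup G c U = {x \<in> carrier G. inv c \<otimes> x \<otimes> c \<in> U}"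
      using mem_conjugate_subgroup [OF U.subset c] by blast
    then show ?thesis
      using c U(2) by (auto intro!: closedin_preimage continuous_group_intros)
  qed
  then show ?thesis
    using F by (auto simp: conjugate_core_def intro!: closedin_Inter)
qed

text \<open>
  The finite intersections of conjugates of \<open>U\<close> shrink to \<open>\<one>\<close>, so by compactness one of them lies in
  \<open>W\<close>. This gives a base of compact open subgroups at \<open>\<one>\<close> straight from the trivial normal core.
\<close>

lemma small_compact_open_subgroup:
  assumes "Hausdorff_space T" and U: "compact_open_subgroup G T U" and core: "normal_core G U = {\<one>}"
    and W: "openin T W" "\<one> \<in> W"
  obtains V where "compact_open_subgroup G T V" "V \<subseteq> W"
proof -
  have Us: "subgroup U G" and Uc: "compactin T U" and Uo: "openin T U"
    using U by (auto simp: compact_open_subgroup_def)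
  interpret U: subgroup U G by fact
  have Ucl: "closedin T U" using compactin_imp_closedin assms(1) Uc by blast
  define \<A> where "\<A> = {conjugate_core G F U | F. finite F \<and> F \<noteq> {} \<and> F \<subseteq> carrier G}"
  have "\<exists>A\<in>\<A>. U \<inter> A \<subseteq> W"
  proof (rule compactin_directed_Inter [OF Uc])
    show "closedin T A" if "A \<in> \<A>" for A
      using that Us Ucl by (auto simp: \<A>_def intro: closedin_conjugate_core)
    show "\<A> \<noteq> {}" unfolding \<A>_def by (auto intro!: exI [of _ "{\<one>}"])
    show "\<exists>D\<in>\<A>. D \<subseteq> A \<inter> B" if "A \<in> \<A>" "B \<in> \<A>" for A B
    proof -
      obtain E F where "A = conjugate_core G E U" "finite E" "E \<noteq> {}" "E \<subseteq> carrier G"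
        "B = conjugate_core G F U" "finite F" "F \<noteq> {}" "F \<subseteq> carrier G"
        using \<open>A \<in> \<A>\<close> \<open>B \<in> \<A>\<close> unfolding \<A>_def by blast
      then have "conjugate_core G (E \<union> F) U \<in> \<A>" "conjugate_core G (E \<union> F) U \<subseteq> A \<inter> B"
        unfolding \<A>_def by (blast, auto simp: conjugate_core_def)
      then show ?thesis by blast
    qed
    have "x = \<one>" if "x \<in> \<Inter>\<A>" for x
    proof -
      have "conjugate_core G {c} U \<in> \<A>" if "c \<in> carrier G" for c
        unfolding \<A>_def using that by blast
      then have "x \<in> normal_core G U"
        using that by (auto simp: normal_core_def conjugate_core_def)
      then show ?thesis using core by simp
    qed
    then show "U \<inter> \<Inter>\<A> \<subseteq> W" using W(2) by blast
    show "openin T W" by fact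
  qed
  then obtain F where F: "finite F" "F \<noteq> {}" "F \<subseteq> carrier G" "U \<inter> conjugate_core G F U \<subseteq> W"
    by (auto simp: \<A>_def)
  have "closedin T (conjugate_core G F U)"
    using Us Ucl F by (intro closedin_conjugate_core)
  moreover have "openin T (conjugate_core G F U)"
    using Us Uo F by (intro openin_conjugate_core)
  moreover have "subgroup (U \<inter> conjugate_core G F U) G"
    using Us F by (intro subgroups_Inter_pair subgroup_conjugate_core)
  ultimately have "compact_open_subgroup G T (U \<inter> conjugate_core G F U)"
    using Uc Uo by (auto simp: compact_open_subgroup_def intro: compact_Int_closedin)
  then show thesis using that F(4) by blast
qed

text \<open>
  Two elements of \<open>p\<Gamma>\<close> in the same left coset of \<open>V\<close> differ by an element of \<open>V \<inter> \<Gamma>\<close>, and finitely many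
  cosets of \<open>V\<close> cover \<open>K\<close>.
\<close>

lemma finite_lattice_translate_Int:
  assumes \<Gamma>: "subgroup \<Gamma> G" and V: "subgroup V G" "openin T V" and "V \<inter> \<Gamma> \<subseteq> {\<one>}"
    and K: "compactin T K" and p: "p \<in> carrier G"
  shows "finite {\<gamma> \<in> \<Gamma>. p \<otimes> \<gamma> \<in> K}"
proof -
  interpret V: subgroup V G by fact
  interpret \<Gamma>: subgroup \<Gamma> G by fact
  obtain R where R: "finite R" "R \<subseteq> carrier G" "\<And>x. x \<in> K \<Longrightarrow> \<exists>r\<in>R. \<exists>v\<in>V. x = r \<otimes> v"
    using finite_cover_compact [OF K V] by blast
  obtain f :: "'a \<Rightarrow> 'a" where f: "finite (f ` K)"
    "\<And>h h'. h \<in> K \<Longrightarrow> h' \<in> K \<Longrightarrow> f h = f h' \<Longrightarrow> inv h \<otimes> h' \<in> V"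
    using cover_by_left_cosetsE [OF V(1) R] by blast
  have "inj_on (\<lambda>\<gamma>. f (p \<otimes> \<gamma>)) {\<gamma> \<in> \<Gamma>. p \<otimes> \<gamma> \<in> K}"
  proof (rule inj_onI)
    fix \<gamma> \<gamma>' assume *: "\<gamma> \<in> {\<gamma> \<in> \<Gamma>. p \<otimes> \<gamma> \<in> K}" "\<gamma>' \<in> {\<gamma> \<in> \<Gamma>. p \<otimes> \<gamma> \<in> K}" "f (p \<otimes> \<gamma>) = f (p \<otimes> \<gamma>')"
    then have "inv (p \<otimes> \<gamma>) \<otimes> (p \<otimes> \<gamma>') \<in> V" using f(2) by simp
    then have "inv \<gamma> \<otimes> \<gamma>' \<in> V" using * p by (simp add: inv_mult_cancel_left)
    then have "inv \<gamma> \<otimes> \<gamma>' = \<one>" using * assms(4) by auto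
    then show "\<gamma> = \<gamma>'" using * by (metis (lifting) \<Gamma>.mem_carrier inv_closed inv_equality inv_inv mem_Collect_eq)
  qed
  moreover have "finite ((\<lambda>\<gamma>. f (p \<otimes> \<gamma>)) ` {\<gamma> \<in> \<Gamma>. p \<otimes> \<gamma> \<in> K})"
    by (rule finite_subset [OF _ f(1)]) auto
  ultimately show ?thesis using finite_imageD by blast
qed

end

section \<open>Joint hulls and their residue\<close>

context topological_group
begin

text \<open>
  This is \<open>A\<^sub>F\<close> of the introduction, for \<open>X = \<Gamma>\<close> and \<open>Y = H\<close>. Taking the cores of both groups over the
  same \<open>F\<close> makes the family directed and equivariant under conjugation.
\<close>

definition joint_hull :: "'a set \<Rightarrow> 'a set \<Rightarrow> 'a set \<Rightarrow> 'a set" where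
  "joint_hull X Y F = T closure_of (generate G (conjugate_core G F X \<union> conjugate_core G F Y))"

context
  fixes X Y
  assumes X: "subgroup X G" and Y: "subgroup Y G"
begin

lemma cores_carrier:
  assumes "F \<subseteq> carrier G" "F \<noteq> {}"
  shows "conjugate_core G F X \<union> conjugate_core G F Y \<subseteq> carrier G"
  using subgroup.subset [OF subgroup_conjugate_core [OF X assms]]
    subgroup.subset [OF subgroup_conjugate_core [OF Y assms]] by blast

lemma subgroup_hull:
  assumes "F \<subseteq> carrier G" "F \<noteq> {}"
  shows "subgroup (joint_hull X Y F) G"
  unfolding joint_hull_def
  by (rule subgroup_closure [OF generate_is_subgroup [OF cores_carrier [OF assms]]])

lemma cores_subset_hull:
  assumes "F \<subseteq> carrier G" "F \<noteq> {}"
  shows "conjugate_core G F X \<union> conjugate_core G F Y \<subseteq> joint_hull X Y F"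
proof -
  let ?S = "conjugate_core G F X \<union> conjugate_core G F Y"
  have "?S \<subseteq> generate G ?S" by (rule subsetI) (rule generate.incl)
  also have "\<dots> \<subseteq> joint_hull X Y F"
    unfolding joint_hull_def
    by (rule subset_closure [OF generate_incl [OF cores_carrier [OF assms]]])
  finally show ?thesis .
qed

lemma hull_minimal:
  assumes "subgroup A G" "closedin T A" "conjugate_core G F X \<subseteq> A" "conjugate_core G F Y \<subseteq> A"
  shows "joint_hull X Y F \<subseteq> A"
  unfolding joint_hull_def
  using assms generate_subgroup_incl [of "conjugate_core G F X \<union> conjugate_core G F Y" A]
  by (intro closure_of_minimal) auto

lemma hull_antimono:
  assumes "F \<subseteq> F'" "F \<noteq> {}" "F' \<subseteq> carrier G"
  shows "joint_hull X Y F' \<subseteq> joint_hull X Y F"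
proof (rule hull_minimal)
  have F: "F \<subseteq> carrier G" "F \<noteq> {}" using assms by auto
  show "subgroup (joint_hull X Y F) G" using F by (rule subgroup_hull)
  show "closedin T (joint_hull X Y F)" by (simp add: joint_hull_def)
  show "conjugate_core G F' X \<subseteq> joint_hull X Y F" "conjugate_core G F' Y \<subseteq> joint_hull X Y F"
    using cores_subset_hull [OF F] conjugate_core_antimono [OF assms(1)] by blast+
qed

lemma hull_translate:
  assumes F: "F \<subseteq> carrier G" "F \<noteq> {}" and g: "g \<in> carrier G" and "x \<in> joint_hull X Y ((\<otimes>) g ` F)"
  shows "inv g \<otimes> x \<otimes> g \<in> joint_hull X Y F"
proof -
  have Xc: "X \<subseteq> carrier G" "Y \<subseteq> carrier G" using X Y by (auto dest: subgroup.subset)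
  interpret A: subgroup "joint_hull X Y F" G using F by (rule subgroup_hull)
  have eq: "conjugate_subgroup G g (joint_hull X Y F) = {x \<in> carrier G. inv g \<otimes> x \<otimes> g \<in> joint_hull X Y F}"
    using mem_conjugate_subgroup [OF A.subset g] by blast
  have "joint_hull X Y ((\<otimes>) g ` F) \<subseteq> conjugate_subgroup G g (joint_hull X Y F)"
  proof (rule hull_minimal)
    show "subgroup (conjugate_subgroup G g (joint_hull X Y F)) G"
      using A.subgroup_axioms g by (rule subgroup_conjugate_subgroup)
    show "closedin T (conjugate_subgroup G g (joint_hull X Y F))"
      unfolding eq using g
      by (intro closedin_preimage continuous_group_intros) (auto simp: joint_hull_def)
    have *: "(\<otimes>) g ` F \<subseteq> carrier G" "(\<otimes>) g ` F \<noteq> {}" using F g by auto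
    have "conjugate_core G ((\<otimes>) g ` F) X \<union> conjugate_core G ((\<otimes>) g ` F) Y
        \<subseteq> conjugate_subgroup G g (joint_hull X Y F)"
    proof
      fix x assume x: "x \<in> conjugate_core G ((\<otimes>) g ` F) X \<union> conjugate_core G ((\<otimes>) g ` F) Y"
      have xc: "x \<in> carrier G" using cores_carrier [OF *] x by blast
      then have "inv g \<otimes> x \<otimes> g \<in> conjugate_core G F X \<union> conjugate_core G F Y"
        using x conj_mem_conjugate_core [OF Xc(1) F g, of x] conj_mem_conjugate_core [OF Xc(2) F g, of x]
        by simp
      then have "inv g \<otimes> x \<otimes> g \<in> joint_hull X Y F"
        using cores_subset_hull [OF F] by (rule rev_subsetD)
      then show "x \<in> conjugate_subgroup G g (joint_hull X Y F)"
        unfolding eq using xc by simp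
    qed
    then show "conjugate_core G ((\<otimes>) g ` F) X \<subseteq> conjugate_subgroup G g (joint_hull X Y F)"
      "conjugate_core G ((\<otimes>) g ` F) Y \<subseteq> conjugate_subgroup G g (joint_hull X Y F)"
      by simp_all
  qed
  then have "x \<in> conjugate_subgroup G g (joint_hull X Y F)"
    using assms(4) by (rule subsetD)
  then show ?thesis by (simp add: eq)
qed

end

definition hull_residue :: "'a set \<Rightarrow> 'a set \<Rightarrow> 'a set \<Rightarrow> 'a set" where
  "hull_residue X Y C = \<Inter>(joint_hull X Y ` {F. finite F \<and> F \<noteq> {} \<and> F \<subseteq> C})"

context
  fixes X Y C :: "'a set"
  assumes X: "subgroup X G" and Y: "subgroup Y G" and C: "subgroup C G"
begin

lemma C_carrier: "F \<subseteq> C \<Longrightarrow> F \<subseteq> carrier G"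
  using subgroup.subset [OF C] by blast

lemma closedin_hull_residue: "closedin T (hull_residue X Y C)"
proof -
  have "{\<one>} \<in> {F. finite F \<and> F \<noteq> {} \<and> F \<subseteq> C}"
    using subgroup.one_closed [OF C] by simp
  then have "joint_hull X Y ` {F. finite F \<and> F \<noteq> {} \<and> F \<subseteq> C} \<noteq> {}" by blast
  then show ?thesis
    unfolding hull_residue_def by (rule closedin_Inter) (auto simp: joint_hull_def)
qed

lemma subgroup_hull_residue: "subgroup (hull_residue X Y C) G"
proof -
  have "{\<one>} \<in> {F. finite F \<and> F \<noteq> {} \<and> F \<subseteq> C}"
    using subgroup.one_closed [OF C] by simp
  then have ne: "joint_hull X Y ` {F. finite F \<and> F \<noteq> {} \<and> F \<subseteq> C} \<noteq> {}" by blast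
  show ?thesis
    unfolding hull_residue_def
  proof (rule subgroups_Inter [OF _ ne])
    fix A assume "A \<in> joint_hull X Y ` {F. finite F \<and> F \<noteq> {} \<and> F \<subseteq> C}"
    then obtain F where "A = joint_hull X Y F" "F \<noteq> {}" "F \<subseteq> C" by blast
    then show "subgroup A G"
      using subgroup_hull [OF X Y C_carrier] by simp
  qed
qed

text \<open>
  Conjugation by \<open>C\<close> permutes the index sets. For fixed \<open>x\<close> in the residue, the elements that conjugate \<open>x\<close> into the
  closed residue form a closed set, so normality passes from \<open>C\<close> to its closure.
\<close>

lemma normal_hull_residue:
  assumes dense: "T closure_of C = topspace T"
  shows "hull_residue X Y C \<lhd> G"
proof -
  interpret C: subgroup C G by (rule C)
  interpret N: subgroup "hull_residue X Y C" G by (rule subgroup_hull_residue)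
  have 1: "c \<otimes> x \<otimes> inv c \<in> hull_residue X Y C" if c: "c \<in> C" and x: "x \<in> hull_residue X Y C" for c x
    unfolding hull_residue_def
  proof (clarify intro!: InterI)
    fix F assume F: "finite F" "F \<noteq> {}" "F \<subseteq> C"
    have "(\<otimes>) (inv c) ` F \<subseteq> C" using F c by auto
    then have "x \<in> joint_hull X Y ((\<otimes>) (inv c) ` F)"
      using x F unfolding hull_residue_def by blast
    then have "inv (inv c) \<otimes> x \<otimes> inv c \<in> joint_hull X Y F"
      using C_carrier [OF F(3)] F(2) c by (intro hull_translate [OF X Y]) auto
    then show "c \<otimes> x \<otimes> inv c \<in> joint_hull X Y F" using c by simp
  qed
  have "g \<otimes> x \<otimes> inv g \<in> hull_residue X Y C" if g: "g \<in> carrier G" and x: "x \<in> hull_residue X Y C" for g x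
  proof (rule closure_subset_preimage [where f = "\<lambda>g. g \<otimes> x \<otimes> inv g"])
    show "continuous_map T T (\<lambda>g. g \<otimes> x \<otimes> inv g)"
      using x by (intro continuous_group_intros) auto
    show "g \<in> T closure_of C" using g dense topspace_eq_carrier by simp
  qed (use 1 x closedin_hull_residue C.subset in auto)
  then show ?thesis
    using subgroup_hull_residue by (simp add: normal_inv_iff)
qed

end

end

section \<open>Local finite generation and faithfulness on lattice cosets\<close>

context topological_group
begin

text \<open>
  The closure \<open>A\<close> of \<open>P\<close> is a subgroup containing an open neighbourhood of \<open>\<one>\<close>, hence open, and then \<open>A \<inter> U\<close> is a
  compact open subgroup in which \<open>P \<inter> U\<close> is dense.
\<close>

lemma locally_finitely_generatedI:
  assumes U: "compact_open_subgroup G T U"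
    and P: "subgroup P G" "finitely_generated_subgroup G (P \<inter> U)"
    and N: "openin T N" "\<one> \<in> N" "N \<subseteq> T closure_of P"
  shows "locally_finitely_generated G T"
proof -
  have Us: "subgroup U G" and Uc: "compactin T U" and Uo: "openin T U"
    using U by (auto simp: compact_open_subgroup_def)
  interpret U: subgroup U G by fact
  interpret P: subgroup P G by fact
  let ?A = "T closure_of P"
  interpret A: subgroup ?A G using P(1) by (rule subgroup_closure)
  have "openin T ?A"
  proof (subst openin_subopen, clarify)
    fix a assume a: "a \<in> ?A"
    have "openin T {x \<in> carrier G. inv a \<otimes> x \<in> N}"
      using a N(1) by (intro openin_preimage continuous_group_intros) auto
    moreover have "x \<in> ?A" if "x \<in> carrier G" "inv a \<otimes> x \<in> N" for x
    proof -
      have "a \<otimes> (inv a \<otimes> x) \<in> ?A" using that(2) N(3) a by blast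
      then show ?thesis using a that(1) by (simp add: m_assoc [symmetric])
    qed
    ultimately show "\<exists>W. openin T W \<and> a \<in> W \<and> W \<subseteq> ?A"
      using a N(2) by (intro exI [of _ "{x \<in> carrier G. inv a \<otimes> x \<in> N}"]) auto
  qed
  then have "openin T (?A \<inter> U)" using Uo by blast
  moreover have "compactin T (?A \<inter> U)"
    using Uc by (intro closed_Int_compactin) auto
  moreover have "subgroup (?A \<inter> U) G"
    using A.subgroup_axioms Us by (rule subgroups_Inter_pair)
  moreover have "subtopology T (?A \<inter> U) closure_of (P \<inter> U) = ?A \<inter> U"
  proof -
    have PA: "P \<subseteq> ?A" using subset_closure P.subset by blast
    have "U \<inter> ?A \<subseteq> T closure_of (U \<inter> P)"
      using openin_Int_closure_of_subset [OF Uo, of P] .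
    moreover have "(?A \<inter> U) \<inter> (P \<inter> U) = U \<inter> P" using PA by blast
    ultimately show ?thesis
      by (auto simp: closure_of_subtopology)
  qed
  moreover have "P \<inter> U \<subseteq> ?A \<inter> U" using subset_closure P.subset by blast
  ultimately show ?thesis
    using P(2) unfolding locally_finitely_generated_def compact_open_subgroup_def
      topologically_finitely_generated_def by blast
qed

text \<open>
  An element fixing every point \<open>gU\<close> of \<open>G / U\<close> lies in the normal core of \<open>U\<close>. The hypothesis says that
  \<open>x\<close> fixes all \<open>\<Gamma>\<close>-translates of the points \<open>k\<inverse>U\<close> with \<open>k \<in> Q\<close>, and by cocompactness these are all
  the points. The inverses enter because \<open>Q\<close> represents cosets on the side \<open>U k \<Gamma>\<close>.
\<close>

lemma faithful_on_lattice_cosets: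
  assumes U: "subgroup U G" and core: "normal_core G U = {\<one>}"
    and \<Gamma>: "subgroup \<Gamma> G"
    and Q: "Q \<subseteq> carrier G" "\<And>g. g \<in> carrier G \<Longrightarrow> \<exists>u\<in>U. \<exists>k\<in>Q. \<exists>\<gamma>\<in>\<Gamma>. g = u \<otimes> k \<otimes> \<gamma>"
    and x: "x \<in> carrier G"
    and fix_all: "\<And>\<gamma>. \<gamma> \<in> \<Gamma> \<Longrightarrow> inv \<gamma> \<otimes> x \<otimes> \<gamma> \<in> conjugate_core G (m_inv G ` Q) U"
  shows "x = \<one>"
proof -
  interpret U: subgroup U G by fact
  interpret \<Gamma>: subgroup \<Gamma> G by fact
  have "inv g \<otimes> x \<otimes> g \<in> U" if g: "g \<in> carrier G" for g
  proof -
    obtain u k \<gamma> where *: "u \<in> U" "k \<in> Q" "\<gamma> \<in> \<Gamma>" "inv g = u \<otimes> k \<otimes> \<gamma>"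
      using Q(2) [of "inv g"] g by auto
    have c: "k \<in> carrier G" "\<gamma> \<in> carrier G" "u \<in> carrier G" using * Q(1) by auto
    have "inv (inv \<gamma>) \<otimes> x \<otimes> inv \<gamma> \<in> conjugate_core G (m_inv G ` Q) U"
      using * by (intro fix_all) simp
    then have "inv (inv k) \<otimes> (\<gamma> \<otimes> x \<otimes> inv \<gamma>) \<otimes> inv k \<in> U"
      using c *(2) Q(1) by (subst (asm) mem_conjugate_core [OF U.subset]) auto
    then have "u \<otimes> (k \<otimes> (\<gamma> \<otimes> x \<otimes> inv \<gamma>) \<otimes> inv k) \<otimes> inv u \<in> U"
      using * c by simp
    moreover have "u \<otimes> (k \<otimes> (\<gamma> \<otimes> x \<otimes> inv \<gamma>) \<otimes> inv k) \<otimes> inv u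
        = (u \<otimes> k \<otimes> \<gamma>) \<otimes> x \<otimes> inv (u \<otimes> k \<otimes> \<gamma>)"
      using c x by (simp add: m_assoc inv_mult_group)
    ultimately show ?thesis using *(4) g by (metis inv_inv)
  qed
  then have "x \<in> normal_core G U"
    using x by (simp add: normal_core_def mem_conjugate_subgroup [OF U.subset])
  then show ?thesis using core by simp
qed

end

section \<open>Discreteness of a joint hull and virtual containment\<close>

context topological_group
begin

text \<open>
  Triviality of \<open>V\<close> against the whole residue is inherited by one hull. Compactness alone would only make
  a hull meet \<open>V\<close> in a small set. Here it is used to force the intersection of the hull with \<open>V\<close> into the conjugates of \<open>V\<close> by
  the finitely many generators of \<open>\<Gamma>\<close>; if this holds simultaneously at all \<open>\<Gamma>\<close>-translates,
  it propagates along words to all conjugates, whose intersection is trivial.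
\<close>

lemma hull_avoids_compact_open_subgroup:
  assumes \<Gamma>: "subgroup \<Gamma> G" "finitely_generated_subgroup G \<Gamma>"
    and H: "subgroup H G" and C: "subgroup C G" "\<Gamma> \<subseteq> C"
    and fi: "\<And>c. c \<in> C \<Longrightarrow> finite_index G (\<Gamma> \<inter> conjugate_subgroup G c \<Gamma>) \<Gamma>"
    and V: "compact_open_subgroup G T V"
    and res: "V \<inter> hull_residue \<Gamma> H C \<subseteq> {\<one>}"
    and core: "\<And>x. x \<in> carrier G \<Longrightarrow> (\<And>\<gamma>. \<gamma> \<in> \<Gamma> \<Longrightarrow> inv \<gamma> \<otimes> x \<otimes> \<gamma> \<in> V) \<Longrightarrow> x = \<one>"
  obtains F where "finite F" "\<one> \<in> F" "F \<subseteq> C" "joint_hull \<Gamma> H F \<inter> V \<subseteq> {\<one>}"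
proof -
  interpret \<Gamma>: subgroup \<Gamma> G by fact
  interpret C: subgroup C G by fact
  have Vs: "subgroup V G" and Vc: "compactin T V" and Vo: "openin T V"
    using V by (auto simp: compact_open_subgroup_def)
  interpret V: subgroup V G by fact
  obtain S where S: "finite S" "S \<subseteq> carrier G" "\<Gamma> = generate G S"
    using \<Gamma>(2) by (auto simp: finitely_generated_subgroup_def)
  define S' where "S' = S \<union> m_inv G ` S"
  have S': "finite S'" "S' \<subseteq> \<Gamma>"
    using S by (auto simp: S'_def generate.incl generate.inv)
  define \<F> where "\<F> = {F. finite F \<and> F \<noteq> {} \<and> F \<subseteq> C}"
  have hull_mono: "joint_hull \<Gamma> H F' \<subseteq> joint_hull \<Gamma> H F" if "F \<subseteq> F'" "F \<in> \<F>" "F' \<in> \<F>" for F F'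
    using that C.subset by (intro hull_antimono [OF \<Gamma>(1) H]) (auto simp: \<F>_def)
  have "\<exists>F\<in>\<F>. V \<inter> joint_hull \<Gamma> H F \<subseteq> conjugate_subgroup G s V" if s: "s \<in> S'" for s
  proof -
    have sc: "s \<in> carrier G" using s S' by auto
    have "\<exists>A\<in>joint_hull \<Gamma> H ` \<F>. V \<inter> A \<subseteq> conjugate_subgroup G s V"
    proof (rule compactin_directed_Inter [OF Vc])
      show "closedin T A" if "A \<in> joint_hull \<Gamma> H ` \<F>" for A
        using that by (auto simp: joint_hull_def)
      have "{\<one>} \<in> \<F>" by (simp add: \<F>_def)
      then show "joint_hull \<Gamma> H ` \<F> \<noteq> {}" by blast
      show "\<exists>D\<in>joint_hull \<Gamma> H ` \<F>. D \<subseteq> A \<inter> B"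
        if "A \<in> joint_hull \<Gamma> H ` \<F>" "B \<in> joint_hull \<Gamma> H ` \<F>" for A B
      proof -
        obtain E F where EF: "E \<in> \<F>" "A = joint_hull \<Gamma> H E" "F \<in> \<F>" "B = joint_hull \<Gamma> H F"
          using \<open>A \<in> _\<close> \<open>B \<in> _\<close> by blast
        then have "E \<union> F \<in> \<F>" by (auto simp: \<F>_def)
        then show ?thesis
          using EF hull_mono [of E "E \<union> F"] hull_mono [of F "E \<union> F"] by blast
      qed
      show "openin T (conjugate_subgroup G s V)"
        using openin_conjugate_core [OF Vs Vo, of "{s}"] sc by (simp add: conjugate_core_def)
      have "{\<one>} \<subseteq> conjugate_subgroup G s V"
        using subgroup.one_closed [OF subgroup_conjugate_subgroup [OF Vs sc]] by simp
      with res have "V \<inter> hull_residue \<Gamma> H C \<subseteq> conjugate_subgroup G s V"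
        by (rule subset_trans)
      then show "V \<inter> \<Inter>(joint_hull \<Gamma> H ` \<F>) \<subseteq> conjugate_subgroup G s V"
        by (simp only: hull_residue_def \<F>_def)
    qed
    then show ?thesis by blast
  qed
  then obtain F where F: "\<And>s. s \<in> S' \<Longrightarrow> F s \<in> \<F>"
      "\<And>s. s \<in> S' \<Longrightarrow> V \<inter> joint_hull \<Gamma> H (F s) \<subseteq> conjugate_subgroup G s V"
    by metis
  define E where "E = insert \<one> (\<Union>s\<in>S'. F s)"
  have E: "E \<in> \<F>" using F(1) S'(1) by (auto simp: E_def \<F>_def)
  have Ec: "E \<subseteq> carrier G" "E \<noteq> {}" "finite E" "E \<subseteq> C" using E C.subset by (auto simp: \<F>_def)
  let ?A = "joint_hull \<Gamma> H E"
  interpret A: subgroup ?A G by (rule subgroup_hull [OF \<Gamma>(1) H Ec(1,2)])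
  have step: "inv s \<otimes> x \<otimes> s \<in> V" if "s \<in> S'" "x \<in> V" "x \<in> ?A" for s x
  proof -
    have "?A \<subseteq> joint_hull \<Gamma> H (F s)"
      using that(1) F(1) E by (intro hull_mono) (auto simp: E_def)
    then have "x \<in> conjugate_subgroup G s V" using F(2) that by blast
    moreover have "s \<in> carrier G" using that(1) S' by auto
    ultimately show ?thesis by (simp add: mem_conjugate_subgroup [OF V.subset])
  qed
  have "finite_index G (\<Gamma> \<inter> conjugate_core G E \<Gamma>) \<Gamma>"
    using \<Gamma>(1) Ec fi by (intro finite_index_conjugate_core) auto
  then obtain R where R: "finite R" "R \<subseteq> \<Gamma>"
      "\<And>\<gamma>. \<gamma> \<in> \<Gamma> \<Longrightarrow> \<exists>r\<in>R. \<exists>\<delta>\<in>\<Gamma> \<inter> conjugate_core G E \<Gamma>. \<gamma> = r \<otimes> \<delta>"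
    using finite_indexD by blast
  have RE: "(\<otimes>) r ` E \<subseteq> C" if "r \<in> R" for r
  proof
    fix y assume "y \<in> (\<otimes>) r ` E"
    then obtain e where "e \<in> E" "y = r \<otimes> e" by blast
    moreover have "r \<in> C" using that R(2) C(2) by blast
    ultimately show "y \<in> C" using Ec(4) by blast
  qed
  \<comment> \<open>\<open>\<gamma>\<close> conjugates the hull of \<open>E\<close> to a group that depends only on the coset of \<open>\<gamma>\<close> modulo the core
    of \<open>\<Gamma>\<close>, which lies in that hull. So the representatives in \<open>R\<close> account for all conjugates.\<close>
  define F' where "F' = insert \<one> (\<Union>r\<in>R. (\<otimes>) r ` E)"
  have F': "finite F'" "F' \<subseteq> C" "\<one> \<in> F'"
    using R(1) Ec(3) RE by (auto simp: F'_def)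
  have F'c: "F' \<subseteq> carrier G" "F' \<noteq> {}" using F' C.subset by auto
  interpret A': subgroup "joint_hull \<Gamma> H F'" G by (rule subgroup_hull [OF \<Gamma>(1) H F'c])
  have conj: "inv \<gamma> \<otimes> x \<otimes> \<gamma> \<in> ?A" if x: "x \<in> joint_hull \<Gamma> H F'" and \<gamma>: "\<gamma> \<in> \<Gamma>" for x \<gamma>
  proof -
    obtain r \<delta> where r: "r \<in> R" "\<delta> \<in> conjugate_core G E \<Gamma>" "\<gamma> = r \<otimes> \<delta>" "\<delta> \<in> \<Gamma>"
      using R(3) [OF \<gamma>] by blast
    have rc: "r \<in> carrier G" "r \<in> \<Gamma>" using r(1) R(2) by auto
    have "(\<otimes>) r ` E \<in> \<F>" using Ec(2,3) RE [OF r(1)] by (simp add: \<F>_def)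
    moreover have "F' \<in> \<F>" using F' by (auto simp: \<F>_def)
    moreover have "(\<otimes>) r ` E \<subseteq> F'" using r(1) by (auto simp: F'_def)
    ultimately have "x \<in> joint_hull \<Gamma> H ((\<otimes>) r ` E)" using x hull_mono by blast
    then have "inv r \<otimes> x \<otimes> r \<in> ?A"
      by (rule hull_translate [OF \<Gamma>(1) H Ec(1,2) rc(1)])
    moreover have "\<delta> \<in> ?A"
      using cores_subset_hull [OF \<Gamma>(1) H Ec(1,2)] r(2) by blast
    ultimately have "inv \<delta> \<otimes> (inv r \<otimes> x \<otimes> r) \<otimes> \<delta> \<in> ?A" by simp
    moreover have "x \<in> carrier G" using x by simp
    ultimately show ?thesis
      using conj_conj [OF rc(1), of \<delta> x] r(3,4) by simp
  qed
  have "x = \<one>" if x: "x \<in> joint_hull \<Gamma> H F'" "x \<in> V" for x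
  proof (rule core)
    show xc: "x \<in> carrier G" using x(2) by simp
    define Y where "Y = {\<gamma> \<in> \<Gamma>. inv \<gamma> \<otimes> x \<otimes> \<gamma> \<in> V}"
    have Ys: "y \<otimes> s \<in> Y" if "y \<in> Y" "s \<in> S'" for y s
    proof -
      have y: "y \<in> \<Gamma>" "inv y \<otimes> x \<otimes> y \<in> V" using that(1) by (auto simp: Y_def)
      have s: "s \<in> \<Gamma>" using that(2) S' by auto
      have "inv s \<otimes> (inv y \<otimes> x \<otimes> y) \<otimes> s \<in> V"
        using step [OF that(2) y(2) conj [OF x(1) y(1)]] .
      then show ?thesis
        using conj_conj [of y s x] y(1) s xc by (simp add: Y_def)
    qed
    have "\<Gamma> \<subseteq> Y"
      unfolding S(3)
    proof (rule generate_right_closed [OF S(2)])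
      show "Y \<subseteq> carrier G" by (auto simp: Y_def)
      show "\<one> \<in> Y" using x(2) by (simp add: Y_def)
    qed (use Ys in \<open>auto simp: S'_def\<close>)
    then show "inv \<gamma> \<otimes> x \<otimes> \<gamma> \<in> V" if "\<gamma> \<in> \<Gamma>" for \<gamma>
      using that by (auto simp: Y_def)
  qed
  then show thesis using that F' by blast
qed

lemma finite_double_cosets_finite_index:
  assumes \<Gamma>: "subgroup \<Gamma> G" and cpt: "compact_space (coset_topology G T \<Gamma>)"
    and V: "subgroup V G" "openin T V" and fi: "finite_index G \<Delta> \<Gamma>"
  obtains Q where "finite Q" "Q \<subseteq> carrier G"
    "\<And>g. g \<in> carrier G \<Longrightarrow> \<exists>v\<in>V. \<exists>k\<in>Q. \<exists>\<delta>\<in>\<Delta>. g = v \<otimes> k \<otimes> \<delta>"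
proof -
  have \<Delta>: "subgroup \<Delta> G" using fi by (simp add: finite_index_def)
  obtain Q where Q: "finite Q" "Q \<subseteq> carrier G"
    "\<And>g. g \<in> carrier G \<Longrightarrow> \<exists>v\<in>V. \<exists>k\<in>Q. \<exists>\<gamma>\<in>\<Gamma>. g = v \<otimes> k \<otimes> \<gamma>"
    by (rule finite_double_cosets [OF \<Gamma> cpt V]) blast
  obtain R where R: "finite R" "R \<subseteq> \<Gamma>" "\<And>\<gamma>. \<gamma> \<in> \<Gamma> \<Longrightarrow> \<exists>r\<in>R. \<exists>\<delta>\<in>\<Delta>. \<gamma> = r \<otimes> \<delta>"
    by (rule finite_indexD [OF fi]) blast
  have Rc: "R \<subseteq> carrier G" using R(2) subgroup.subset [OF \<Gamma>] by blast
  show thesis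
  proof
    show "finite ((\<lambda>(k, r). k \<otimes> r) ` (Q \<times> R))" using Q(1) R(1) by simp
    show "(\<lambda>(k, r). k \<otimes> r) ` (Q \<times> R) \<subseteq> carrier G" using Q(2) Rc by (auto intro!: m_closed)
    fix g assume "g \<in> carrier G"
    then obtain v k \<gamma> where g: "v \<in> V" "k \<in> Q" "\<gamma> \<in> \<Gamma>" "g = v \<otimes> k \<otimes> \<gamma>" using Q(3) by blast
    obtain r \<delta> where r: "r \<in> R" "\<delta> \<in> \<Delta>" "\<gamma> = r \<otimes> \<delta>" using R(3) [OF g(3)] by blast
    have "v \<in> carrier G" "k \<in> carrier G" "r \<in> carrier G" "\<delta> \<in> carrier G"
      using g(1,2) r(1,2) Q(2) Rc subgroup.subset [OF V(1)] subgroup.subset [OF \<Delta>] by blast+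
    then have "g = v \<otimes> (k \<otimes> r) \<otimes> \<delta>" unfolding g(4) r(3) by (simp add: m_assoc)
    then show "\<exists>v\<in>V. \<exists>q\<in>(\<lambda>(k, r). k \<otimes> r) ` (Q \<times> R). \<exists>\<delta>\<in>\<Delta>. g = v \<otimes> q \<otimes> \<delta>"
      using g(1,2) r(1,2) by blast
  qed
qed

end

context tdlc_group
begin

text \<open>
  The hypotheses on normal subgroups and on local finite generation apply to the residue only: it cannot be
  open, so it is discrete, and then some joint hull is discrete.
\<close>

theorem commensurated_virtually_contained_in_lattice:
  assumes lattice: "cocompact_lattice G T \<Gamma>" and \<Gamma>fg: "finitely_generated_subgroup G \<Gamma>"
    and C: "subgroup C G" and dense: "T closure_of C = topspace T"
    and \<Gamma>C: "\<Gamma> \<subseteq> C" and comm: "C \<subseteq> commensurator G \<Gamma>"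
    and U: "compact_open_subgroup G T U" "normal_core G U = {\<one>}"
    and normal: "\<And>N. N \<lhd> G \<Longrightarrow> closedin T N \<Longrightarrow> discrete_subset T N \<or> openin T N"
    and not_lfg: "\<not> locally_finitely_generated G T"
    and Hfg: "finitely_generated_subgroup G H" and Hc: "commensurated_in G H C"
  shows "virtually_contained G H \<Gamma>"
proof -
  interpret C: subgroup C G by (rule C)
  have \<Gamma>: "subgroup \<Gamma> G" and disc: "discrete_subset T \<Gamma>"
    and cpt: "compact_space (coset_topology G T \<Gamma>)"
    using lattice by (auto simp: cocompact_lattice_def)
  have H: "subgroup H G" "H \<subseteq> C" using Hc by (auto simp: commensurated_in_def)
  interpret \<Gamma>: subgroup \<Gamma> G by (rule \<Gamma>)
  interpret H: subgroup H G by (rule H(1))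
  have fi\<Gamma>: "finite_index G (\<Gamma> \<inter> conjugate_subgroup G c \<Gamma>) \<Gamma>" if "c \<in> C" for c
    using that comm by (auto simp: commensurator_def commensurable_def)
  have fiH: "finite_index G (H \<inter> conjugate_subgroup G c H) H" if "c \<in> C" for c
    using that Hc by (auto simp: commensurated_in_def commensurable_def)
  have Us: "subgroup U G" and Uc: "compactin T U" and Uo: "openin T U"
    using U by (auto simp: compact_open_subgroup_def)
  obtain Q where Q: "finite Q" "Q \<subseteq> carrier G"
    "\<And>g. g \<in> carrier G \<Longrightarrow> \<exists>u\<in>U. \<exists>k\<in>Q. \<exists>\<gamma>\<in>\<Gamma>. g = u \<otimes> k \<otimes> \<gamma>"
    by (rule finite_double_cosets [OF \<Gamma> cpt Us Uo]) blast

  define N where "N = hull_residue \<Gamma> H C"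
  define P where "P = generate G (\<Gamma> \<union> H)"
  have \<Gamma>H: "\<Gamma> \<union> H \<subseteq> carrier G" by auto
  have P: "subgroup P G" unfolding P_def using \<Gamma>H by (rule generate_is_subgroup)
  have "\<not> openin T N"
  proof
    assume No: "openin T N"
    obtain W where W: "openin T W" "W \<inter> \<Gamma> = {\<one>}"
      using discrete_subset_isolated [OF disc \<Gamma>.one_closed] by blast
    then have "\<one> \<in> W" by blast
    then obtain V where V: "compact_open_subgroup G T V" "V \<subseteq> W"
      by (rule small_compact_open_subgroup [OF Hausdorff U W(1)]) blast
    have "finitely_generated_subgroup G (P \<inter> U)"
    proof (rule finitely_generated_Int [OF Us \<Gamma> _ _ _ Q(1,2)])
      show "finitely_generated_subgroup G P"
        unfolding P_def using \<Gamma>fg Hfg by (rule finitely_generated_Un)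
      show "\<Gamma> \<subseteq> P" unfolding P_def by (auto intro: generate.incl)
      have PC: "P \<subseteq> C"
        unfolding P_def using \<Gamma>C H(2) C by (intro generate_subgroup_incl) auto
      show "finite_index G (\<Gamma> \<inter> conjugate_subgroup G p \<Gamma>) \<Gamma>" if "p \<in> P" for p
        using that PC fi\<Gamma> by blast
      show "\<exists>u\<in>U. \<exists>k\<in>Q. \<exists>\<gamma>\<in>\<Gamma>. p = u \<otimes> k \<otimes> \<gamma>" if "p \<in> P" for p
        using that Q(3) subgroup.subset [OF P] by blast
      show "finite {\<gamma> \<in> \<Gamma>. p \<otimes> \<gamma> \<in> U}" if "p \<in> P" for p
      proof (rule finite_lattice_translate_Int [OF \<Gamma>])
        show "subgroup V G" "openin T V" using V(1) by (auto simp: compact_open_subgroup_def)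
        show "V \<inter> \<Gamma> \<subseteq> {\<one>}" using V(2) W(2) by blast
        show "compactin T U" by fact
        show "p \<in> carrier G" using that subgroup.subset [OF P] by blast
      qed
    qed
    moreover have "\<one> \<in> N"
      unfolding N_def using subgroup_hull_residue [OF \<Gamma> H(1) C] by (rule subgroup.one_closed)
    moreover have "N \<subseteq> T closure_of P"
    proof -
      have "N \<subseteq> joint_hull \<Gamma> H {\<one>}"
        unfolding N_def hull_residue_def using C.one_closed by blast
      then show ?thesis
        by (simp add: joint_hull_def P_def conjugate_core_one [OF \<Gamma>.subset] conjugate_core_one [OF H.subset])
    qed
    ultimately have "locally_finitely_generated G T"
      using locally_finitely_generatedI [OF U(1) P _ No] by blast
    then show False using not_lfg by blast
  qed
  moreover have "N \<lhd> G" "closedin T N"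
    unfolding N_def using normal_hull_residue [OF \<Gamma> H(1) C dense]
      closedin_hull_residue [OF \<Gamma> H(1) C] by blast+
  ultimately have "discrete_subset T N" using normal by blast
  moreover have "\<one> \<in> N"
    unfolding N_def using subgroup_hull_residue [OF \<Gamma> H(1) C] by (rule subgroup.one_closed)
  ultimately obtain W where W: "openin T W" "W \<inter> N = {\<one>}"
    using discrete_subset_isolated by metis

  \<comment> \<open>Contained in \<open>W\<close>, the group \<open>V\<close> avoids the residue; contained in the core over \<open>I\<close>, its
    conjugates under \<open>\<Gamma>\<close> intersect trivially.\<close>
  define I where "I = m_inv G ` Q"
  have "Q \<noteq> {}" using Q(3) [of \<one>] by blast
  then have I: "finite I" "I \<noteq> {}" "I \<subseteq> carrier G" using Q by (auto simp: I_def)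
  have "openin T (W \<inter> conjugate_core G I U)"
    using W(1) openin_conjugate_core [OF Us Uo I] by blast
  moreover have "\<one> \<in> W \<inter> conjugate_core G I U"
    using W(2) subgroup.one_closed [OF subgroup_conjugate_core [OF Us I(3,2)]] by blast
  ultimately obtain V where V: "compact_open_subgroup G T V" "V \<subseteq> W \<inter> conjugate_core G I U"
    by (rule small_compact_open_subgroup [OF Hausdorff U]) blast
  have Vs: "subgroup V G" and Vo: "openin T V"
    using V by (auto simp: compact_open_subgroup_def)
  obtain F where F: "finite F" "\<one> \<in> F" "F \<subseteq> C" "joint_hull \<Gamma> H F \<inter> V \<subseteq> {\<one>}"
  proof (rule hull_avoids_compact_open_subgroup [OF \<Gamma> \<Gamma>fg H(1) C \<Gamma>C fi\<Gamma> V(1)])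
    show "V \<inter> hull_residue \<Gamma> H C \<subseteq> {\<one>}" using V(2) W(2) by (auto simp: N_def)
    show "x = \<one>" if "x \<in> carrier G" "\<And>\<gamma>. \<gamma> \<in> \<Gamma> \<Longrightarrow> inv \<gamma> \<otimes> x \<otimes> \<gamma> \<in> V" for x
    proof (rule faithful_on_lattice_cosets [OF Us U(2) \<Gamma> Q(2,3) that(1)])
      show "inv \<gamma> \<otimes> x \<otimes> \<gamma> \<in> conjugate_core G (m_inv G ` Q) U" if "\<gamma> \<in> \<Gamma>" for \<gamma>
        using \<open>\<And>\<gamma>. \<gamma> \<in> \<Gamma> \<Longrightarrow> inv \<gamma> \<otimes> x \<otimes> \<gamma> \<in> V\<close> [OF that] V(2) by (auto simp: I_def)
    qed
  qed blast

  have Fc: "F \<subseteq> carrier G" "F \<noteq> {}" using F(2,3) C.subset by auto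
  let ?\<Gamma> = "conjugate_core G F \<Gamma>" and ?H = "conjugate_core G F H"
  have sub: "?\<Gamma> \<subseteq> \<Gamma>" "?H \<subseteq> H"
    using F(2) by (auto dest: subsetD [OF conjugate_core_subset [OF \<Gamma>.subset]]
        subsetD [OF conjugate_core_subset [OF H.subset]])
  have "finite_index G (\<Gamma> \<inter> ?\<Gamma>) \<Gamma>" "finite_index G (H \<inter> ?H) H"
    using finite_index_conjugate_core [OF \<Gamma> F(1) Fc(1)] finite_index_conjugate_core [OF H(1) F(1) Fc(1)]
      fi\<Gamma> fiH F(3) by blast+
  then have fi: "finite_index G ?\<Gamma> \<Gamma>" "finite_index G ?H H"
    using sub by (simp_all add: Int_absorb1)
  obtain K where K: "finite K" "K \<subseteq> carrier G"
    "\<And>g. g \<in> carrier G \<Longrightarrow> \<exists>v\<in>V. \<exists>k\<in>K. \<exists>\<delta>\<in>?\<Gamma>. g = v \<otimes> k \<otimes> \<delta>"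
    by (rule finite_double_cosets_finite_index [OF \<Gamma> cpt Vs Vo fi(1)]) blast
  have "finite_index G (?H \<inter> ?\<Gamma>) ?H"
  proof (rule finite_index_Int_if_discrete_cocompact [OF _ Vs F(4) _ _ _ _ K])
    show "subgroup (joint_hull \<Gamma> H F) G" using subgroup_hull [OF \<Gamma> H(1) Fc] .
    show "?\<Gamma> \<subseteq> joint_hull \<Gamma> H F" "?H \<subseteq> joint_hull \<Gamma> H F"
      using cores_subset_hull [OF \<Gamma> H(1) Fc] by auto
    show "subgroup ?\<Gamma> G" "subgroup ?H G"
      using subgroup_conjugate_core [OF \<Gamma> Fc] subgroup_conjugate_core [OF H(1) Fc] .
  qed
  then have "finite_index G (?H \<inter> ?\<Gamma>) H" using fi(2) by (rule finite_index_trans)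
  then show "virtually_contained G H \<Gamma>"
    unfolding virtually_contained_def using sub(1) by blast
qed

end

theorem theorem1:
  fixes G :: "('a, 'b) monoid_scheme" and T :: "'a topology" and \<Gamma> C :: "'a set"
  assumes "tdlc_group G T"
    and "cocompact_lattice G T \<Gamma>"
    and "finitely_generated_subgroup G \<Gamma>"
    and "subgroup C G"
    and "T closure_of C = topspace T"
    and "\<Gamma> \<subseteq> C"
    and "C \<subseteq> commensurator G \<Gamma>"
    and "\<exists>U. compact_open_subgroup G T U \<and> normal_core G U = {\<one>\<^bsub>G\<^esub>}"
    and "\<forall>N. N \<lhd> G \<and> closedin T N \<longrightarrow> discrete_subset T N \<or> openin T N"
    and "\<not> locally_finitely_generated G T"
  shows "\<forall>H. finitely_generated_subgroup G H \<and> commensurated_in G H C \<longrightarrow>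
           virtually_contained G H \<Gamma>"
proof (intro allI impI, elim conjE)
  fix H assume H: "finitely_generated_subgroup G H" "commensurated_in G H C"
  interpret tdlc_group G T by (rule assms(1))
  obtain U where U: "compact_open_subgroup G T U" "normal_core G U = {\<one>\<^bsub>G\<^esub>}"
    using assms(8) by blast
  show "virtually_contained G H \<Gamma>"
    by (rule commensurated_virtually_contained_in_lattice [OF assms(2-7) U _ assms(10) H])
      (use assms(9) in blast)
qed

end
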